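(* Let $G$ be a finite group containing two subgroups $U$ and $V$ which together generate $G$. Consider the conditions (a) $U\cong D_3$, $V\cong D_2$, and $U\cap V\cong\mathbf{Z}/2\mathbf{Z}$; (b) $U\cong D_3$, $V\cong A_4$, and $U\cap V\cong\mathbf{Z}/3\mathbf{Z}$. Then (1) if $|G|=48$ and (a) holds, $G\cong S_4\times\mathbf{Z}/2\mathbf{Z}$, whereas if $|G|=48$ then (b) cannot hold; (2) there is no group $G$ with $|G|=72$ for which (a) or (b) holds.
   Context: $D_n$ denotes the dihedral group of order $2n$ (so $D_2\cong(\mathbf{Z}/2\mathbf{Z})^2$ and $D_3\cong S_3$). *)

theory Defs
  imports "HOL-Algebra.Algebra"
begin

text \<open>Dihedral group D_n of order 2n (n \<ge> 1): elements (k, s) stand for r^k s^[s],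
  with k in {0..<n} (rotation exponent) and s a flag for a reflection.
  Relations: r^n = 1, s^2 = 1, s r s = r^-1.\<close>
definition dihedral_group :: "nat \<Rightarrow> (int \<times> bool) monoid" where
  "dihedral_group n = \<lparr> carrier = {0..<int n} \<times> UNIV,
     monoid.mult = (\<lambda>(a, s) (b, t). ((a + (if s then - b else b)) mod int n, s \<noteq> t)),
     one = (0, False) \<rparr>"

definition cond_a :: "('a, 'b) monoid_scheme \<Rightarrow> 'a set \<Rightarrow> 'a set \<Rightarrow> bool" where
  "cond_a G U V \<longleftrightarrow>
     G\<lparr>carrier := U\<rparr> \<cong> dihedral_group 3 \<and>
     G\<lparr>carrier := V\<rparr> \<cong> dihedral_group 2 \<and>
     G\<lparr>carrier := U \<inter> V\<rparr> \<cong> integer_mod_group 2"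

definition cond_b :: "('a, 'b) monoid_scheme \<Rightarrow> 'a set \<Rightarrow> 'a set \<Rightarrow> bool" where
  "cond_b G U V \<longleftrightarrow>
     G\<lparr>carrier := U\<rparr> \<cong> dihedral_group 3 \<and>
     G\<lparr>carrier := V\<rparr> \<cong> alt_group 4 \<and>
     G\<lparr>carrier := U \<inter> V\<rparr> \<cong> integer_mod_group 3"

end

theory Submission
  imports Defs
begin

text \<open>
  In case (a) write \<open>U = \<langle>a, x\<rangle>\<close> and \<open>V = \<langle>a, c\<rangle>\<close> with \<open>a\<close> generating \<open>U \<inter> V\<close>. A subgroup of index 3 has a
  normal core \<open>N\<close> of index 6, which contains \<open>c\<close> or \<open>a c\<close>; renaming, \<open>c \<in> N\<close>, and then \<open>N\<close> is generated
  by the three \<open>x\<close>-conjugates of \<open>c\<close>. For order 48 these commute, so \<open>G\<close> is determined by its relations.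
  For order 72 a normal subgroup of order 9 or 3 exists, and either one forces \<open>G\<close> to be too small.

  In case (b) the group \<open>G\<close> is too small as soon as the Klein four-subgroup of \<open>V\<close> is normal in \<open>G\<close>. For order 48
  this follows from the core of \<open>V\<close>, and for order 72 from the index-2 subgroup \<open>V \<times> K\<close>, where \<open>K\<close> is
  normal of order 3.
\<close>

text \<open>All upper bounds on orders come from one count: adjoining an element that normalizes a
  subgroup and has n-th power 1 multiplies the order by at most n. In case (a) the core has index 6
  because the quotient has order at most 3! = 6, while \<open>a\<close> survives in it: if
  \<open>a\<close> were killed, so would be \<open>x\<close>, leaving a quotient of order at most 2.
  A group of order 6 has no subgroup of order 4, so the Klein four-group meets the core, in
  \<open>c\<close> or in \<open>a c\<close>. The subgroup of index 3 is a Sylow 2-subgroup when the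
  order is 48. For order 72 a Sylow 2-subgroup has index 9 and its core bound 9! says nothing; it
  must first be enlarged by a normal subgroup of order 3. This is why normal subgroups of order 9 or
  3 are sought beforehand. The locale for case (a) records relations and generation, but no exact
  orders. It therefore applies again after replacing \<open>c\<close> by \<open>a c\<close>, to the
  model inside S4 x Z/2, and to the diagonal subgroup of the direct product of two such groups,
  which yields the isomorphism.\<close>

context group
begin

section \<open>Counting with generators, cosets and normal cores\<close>

lemma inv_cancel_left:
  assumes "a \<in> carrier G" "b \<in> carrier G"
  shows "inv a \<otimes> (a \<otimes> b) = b" "a \<otimes> (inv a \<otimes> b) = b"
  using assms by (simp_all add: m_assoc[symmetric])

lemma conj_generate:
  assumes S: "S \<subseteq> carrier G" and t: "t \<in> carrier G"
    and conj: "\<And>h. h \<in> S \<Longrightarrow> t \<otimes> h \<otimes> inv t \<in> generate G S"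
    and h: "h \<in> generate G S"
  shows "t \<otimes> h \<otimes> inv t \<in> generate G S"
  using h
proof (induction rule: generate.induct)
  case one
  then show ?case using t generate.one by simp
next
  case (incl h)
  then show ?case using conj by blast
next
  case (inv h)
  then have "h \<in> carrier G" using S by blast
  then have "t \<otimes> inv h \<otimes> inv t = inv (t \<otimes> h \<otimes> inv t)"
    using t by (simp add: inv_mult_group m_assoc)
  then show ?case
    using conj[OF inv] generate_m_inv_closed[OF S] by simp
next
  case (eng h1 h2)
  have c: "h1 \<in> carrier G" "h2 \<in> carrier G"
    using eng generate_in_carrier[OF S] by auto
  have "t \<otimes> (h1 \<otimes> h2) \<otimes> inv t = (t \<otimes> h1 \<otimes> inv t) \<otimes> (t \<otimes> h2 \<otimes> inv t)"
    using t c by (simp add: m_assoc inv_cancel_left)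
  then show ?case using eng generate.eng by metis
qed

lemma conj_pow_subgroup:
  assumes H: "subgroup H G" and t: "t \<in> carrier G"
    and conj: "\<And>h. h \<in> H \<Longrightarrow> t \<otimes> h \<otimes> inv t \<in> H"
  shows "h \<in> H \<Longrightarrow> t [^] (i::nat) \<otimes> h \<otimes> inv (t [^] i) \<in> H"
proof (induction i arbitrary: h)
  case 0
  then show ?case using subgroup.mem_carrier[OF H] by simp
next
  case (Suc i)
  have h: "h \<in> carrier G" using Suc subgroup.mem_carrier[OF H] by simp
  have "t [^] Suc i \<otimes> h \<otimes> inv (t [^] Suc i)
      = t [^] i \<otimes> (t \<otimes> h \<otimes> inv t) \<otimes> inv (t [^] i)"
    using t h by (simp add: m_assoc inv_mult_group)
  then show ?case using Suc conj by simp
qed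

text \<open>Since \<open>t\<close> normalizes the subgroup generated by \<open>S\<close>, the
  products of its elements with powers of \<open>t\<close> already form a subgroup. Only an
  inequality can be expected, because a smaller power of \<open>t\<close> may lie in that
  subgroup.\<close>

lemma card_generate_insert_le:
  assumes fin: "finite (carrier G)" and S: "S \<subseteq> carrier G" and t: "t \<in> carrier G"
    and n: "0 < n" "t [^] (n::nat) = \<one>"
    and conj: "\<And>h. h \<in> S \<Longrightarrow> t \<otimes> h \<otimes> inv t \<in> generate G S"
  shows "card (generate G (insert t S)) \<le> n * card (generate G S)"
proof -
  define H where "H = generate G S"
  have H: "subgroup H G" unfolding H_def by (rule generate_is_subgroup[OF S])
  note HC = subgroup.mem_carrier[OF H]
  have cj: "t [^] (i::nat) \<otimes> h \<otimes> inv (t [^] i) \<in> H" if "h \<in> H" for i h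
    by (rule conj_pow_subgroup[OF H t _ that]) (use conj_generate[OF S t conj] H_def in blast)
  define T where "T = (\<lambda>(h, i). h \<otimes> t [^] (i::nat)) ` (H \<times> {..<n})"
  \<comment> \<open>Exponents are reduced modulo \<open>n\<close> here once, so that closure of
    \<open>T\<close> can be checked with arbitrary powers of \<open>t\<close>.\<close>
  have TI: "h \<otimes> t [^] (i::nat) \<in> T" if "h \<in> H" for h i
  proof -
    have "t [^] i = t [^] (n * (i div n) + i mod n)" by simp
    also have "\<dots> = (t [^] n) [^] (i div n) \<otimes> t [^] (i mod n)"
      using t by (simp only: nat_pow_mult[symmetric] nat_pow_pow)
    finally have "t [^] i = t [^] (i mod n)" using t n by simp
    then show ?thesis unfolding T_def using that n by force
  qed
  have TC: "T \<subseteq> carrier G" unfolding T_def using HC t by auto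
  have mul: "x \<otimes> y \<in> T" if "x \<in> T" "y \<in> T" for x y
  proof -
    obtain h i k j where xy: "x = h \<otimes> t [^] (i::nat)" "y = k \<otimes> t [^] (j::nat)" "h \<in> H" "k \<in> H"
      using \<open>x \<in> T\<close> \<open>y \<in> T\<close> unfolding T_def by auto
    have c: "h \<in> carrier G" "k \<in> carrier G" using xy HC by auto
    have "x \<otimes> y = h \<otimes> (t [^] i \<otimes> k \<otimes> inv (t [^] i)) \<otimes> t [^] (i + j)"
      unfolding xy using c t by (simp add: m_assoc nat_pow_mult[symmetric] inv_cancel_left)
    then show ?thesis using TI subgroup.m_closed[OF H xy(3) cj[OF xy(4)]] by metis
  qed
  have inv: "inv x \<in> T" if "x \<in> T" for x
  proof -
    obtain h i where x: "x = h \<otimes> t [^] (i::nat)" "h \<in> H" "i < n"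
      using \<open>x \<in> T\<close> unfolding T_def by auto
    have c: "h \<in> carrier G" using x HC by auto
    have "t [^] (n - i) \<otimes> t [^] i = \<one>"
      using t n x by (simp add: nat_pow_mult)
    then have ti: "inv (t [^] i) = t [^] (n - i)" using t by (intro inv_equality) auto
    have "inv x = (t [^] (n - i) \<otimes> inv h \<otimes> inv (t [^] (n - i))) \<otimes> t [^] (n - i)"
      unfolding x ti[symmetric] using c t by (simp add: m_assoc inv_mult_group)
    then show ?thesis using TI[OF cj[OF subgroup.m_inv_closed[OF H x(2)]]] by metis
  qed
  have "\<one> \<in> T" using TI[OF subgroup.one_closed[OF H], of 0] by simp
  then have "subgroup T G" using TC mul inv by (intro subgroupI) auto
  moreover have "insert t S \<subseteq> T"
  proof -
    have "t \<in> T" using TI[OF subgroup.one_closed[OF H], of 1] t by simp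
    moreover have "s \<in> T" if "s \<in> S" for s
    proof -
      have "s \<in> H" using generate.incl[OF that] unfolding H_def .
      then show ?thesis using TI[of s 0] HC by simp
    qed
    ultimately show ?thesis by blast
  qed
  ultimately have "generate G (insert t S) \<subseteq> T" by (rule generate_subgroup_incl[rotated])
  moreover have fH: "finite H" using fin finite_subset subgroup.subset[OF H] by blast
  moreover have fT: "finite T" unfolding T_def using fH by simp
  ultimately have "card (generate G (insert t S)) \<le> card T" by (intro card_mono) auto
  also have "\<dots> \<le> card (H \<times> {..<n})" unfolding T_def using fH by (intro card_image_le) simp
  finally show ?thesis by (simp add: H_def card_cartesian_product mult.commute)
qed

lemma rcoset_mult_permutes:
  assumes "subgroup M G" "g \<in> carrier G"
  shows "(\<lambda>C. if C \<in> rcosets M then C #> g else C) permutes (rcosets M)"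
proof -
  interpret M: subgroup M G by fact
  have sub: "C \<subseteq> carrier G" if "C \<in> rcosets M" for C
    using M.rcosets_carrier[OF is_group that] by simp
  have act: "C #> h \<in> rcosets M" if "C \<in> rcosets M" "h \<in> carrier G" for C h
    using that coset_mult_assoc[OF M.subset] unfolding RCOSETS_def by auto
  have "bij_betw (\<lambda>C. C #> g) (rcosets M) (rcosets M)"
    by (rule bij_betw_byWitness[where f'="\<lambda>C. C #> inv g"])
      (use assms(2) act sub coset_mult_assoc in auto)
  then have "bij_betw (\<lambda>C. if C \<in> rcosets M then C #> g else C) (rcosets M) (rcosets M)"
    by (simp cong: bij_betw_cong)
  then show ?thesis by (rule bij_imp_permutes) simp
qed

text \<open>\<open>N\<close> is the kernel of the action of \<open>G\<close> by right multiplication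
  on the right cosets of \<open>M\<close>, whence the factorial. A normal subgroup inside
  \<open>M\<close> fixes every coset, so it lies in the kernel.\<close>

lemma normal_core:
  assumes fin: "finite (carrier G)" and M: "subgroup M G"
  obtains N where "N \<lhd> G" "N \<subseteq> M" "card (carrier G) \<le> fact (card (rcosets M)) * card N"
    "\<And>K. K \<lhd> G \<Longrightarrow> K \<subseteq> M \<Longrightarrow> K \<subseteq> N"
proof -
  interpret M: subgroup M G by fact
  define N where "N = {g \<in> carrier G. \<forall>C \<in> rcosets M. C #> g = C}"
  have sub: "C \<subseteq> carrier G" if "C \<in> rcosets M" for C
    using M.rcosets_carrier[OF is_group that] by simp
  have act: "C #> h \<in> rcosets M" if "C \<in> rcosets M" "h \<in> carrier G" for C h
    using that coset_mult_assoc[OF M.subset] unfolding RCOSETS_def by auto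
  have frc: "finite (rcosets M)" using fin rcosets_subset_PowG[OF M] 
    by (meson finite_Pow_iff finite_subset)
  have sg: "subgroup N G"
  proof (rule subgroupI)
    show "N \<subseteq> carrier G" unfolding N_def by blast
    have "\<one> \<in> N" unfolding N_def using sub by simp
    then show "N \<noteq> {}" by blast
    show "a \<otimes> b \<in> N" if "a \<in> N" "b \<in> N" for a b
      using that sub unfolding N_def by (auto simp: coset_mult_assoc[symmetric])
    show "inv a \<in> N" if "a \<in> N" for a
    proof -
      have "C #> inv a = C" if "C \<in> rcosets M" for C
        using \<open>a \<in> N\<close> that sub[OF that] coset_mult_assoc[of C a "inv a"] unfolding N_def by simp
      then show ?thesis using that unfolding N_def by simp
    qed
  qed
  have "N \<lhd> G"
  proof (rule normal_invI[OF sg])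
    fix x h assume xh: "x \<in> carrier G" "h \<in> N"
    have h: "h \<in> carrier G" using xh N_def by simp
    have "C #> (x \<otimes> h \<otimes> inv x) = C" if C: "C \<in> rcosets M" for C
    proof -
      have "C #> (x \<otimes> h \<otimes> inv x) = ((C #> x) #> h) #> inv x"
        using xh h sub[OF C] by (simp add: coset_mult_assoc r_coset_subset_G m_assoc)
      also have "(C #> x) #> h = C #> x" using xh act[OF C xh(1)] unfolding N_def by blast
      also have "(C #> x) #> inv x = C" using xh sub[OF C] by (simp add: coset_mult_assoc)
      finally show ?thesis .
    qed
    then show "x \<otimes> h \<otimes> inv x \<in> N" using xh h unfolding N_def by simp
  qed
  moreover have "N \<subseteq> M"
  proof
    fix g assume "g \<in> N"
    then have "g \<in> carrier G" "M #> g = M"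
      using M.subgroup_in_rcosets[OF is_group] unfolding N_def by auto
    then show "g \<in> M" using coset_join1 M.subset M by blast
  qed
  moreover have "card (carrier G) \<le> fact (card (rcosets M)) * card N"
  proof -
    \<comment> \<open>The action as a map into permutations; it is the identity off the cosets, as
      \<open>permutes\<close> demands.\<close>
    define \<phi> where "\<phi> g = (\<lambda>C. if C \<in> rcosets M then C #> g else C)" for g
    let ?P = "{p. p permutes (rcosets M)}"
    have im: "\<phi> ` carrier G \<subseteq> ?P" using rcoset_mult_permutes[OF M] unfolding \<phi>_def by blast
    \<comment> \<open>A nonempty fibre through \<open>g\<close> lies in the coset of
      \<open>N\<close> through \<open>g\<close>, so |G| is at most the number of permutations times
      |N|.\<close>
    have fibre: "card {g \<in> carrier G. \<phi> g = p} \<le> card N" for p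
    proof (cases "\<exists>g \<in> carrier G. \<phi> g = p")
      case True
      then obtain g where g: "g \<in> carrier G" "\<phi> g = p" by blast
      have "{k \<in> carrier G. \<phi> k = p} \<subseteq> (\<lambda>n. n \<otimes> g) ` N"
      proof
        fix k assume "k \<in> {k \<in> carrier G. \<phi> k = p}"
        then have k: "k \<in> carrier G" "\<phi> k = \<phi> g" using g by auto
        have "C #> (k \<otimes> inv g) = C" if C: "C \<in> rcosets M" for C
        proof -
          have "C #> k = C #> g" using fun_cong[OF k(2), of C] C unfolding \<phi>_def by simp
          then have "C #> k #> inv g = C #> g #> inv g" by simp
          then show ?thesis using k g sub[OF C] by (simp add: coset_mult_assoc)
        qed
        then have "k \<otimes> inv g \<in> N" using k g unfolding N_def by simp
        moreover have "k = k \<otimes> inv g \<otimes> g" using k g by (simp add: m_assoc)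
        ultimately show "k \<in> (\<lambda>n. n \<otimes> g) ` N" by blast
      qed
      then have "card {k \<in> carrier G. \<phi> k = p} \<le> card ((\<lambda>n. n \<otimes> g) ` N)"
        using fin N_def by (intro card_mono) auto
      also have "\<dots> \<le> card N" using fin N_def by (intro card_image_le) auto
      finally show ?thesis .
    next
      case False
      then have "{g \<in> carrier G. \<phi> g = p} = {}" by blast
      then show ?thesis by (simp only: card.empty)
    qed
    have "carrier G = (\<Union>p\<in>?P. {g \<in> carrier G. \<phi> g = p})" using im by auto
    then have "card (carrier G) = card (\<Union>p\<in>?P. {g \<in> carrier G. \<phi> g = p})" by simp
    also have "\<dots> \<le> (\<Sum>p\<in>?P. card {g \<in> carrier G. \<phi> g = p})"
      by (rule card_UN_le[OF finite_permutations[OF frc]])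
    also have "\<dots> \<le> (\<Sum>p\<in>?P. card N)" by (rule sum_mono) (rule fibre)
    also have "\<dots> = fact (card (rcosets M)) * card N"
      using card_permutations[OF refl frc] by simp
    finally show ?thesis .
  qed
  moreover have "K \<subseteq> N" if K: "K \<lhd> G" "K \<subseteq> M" for K
  proof
    fix k assume k: "k \<in> K"
    have kC: "k \<in> carrier G" using k K(2) M.subset by blast
    have "C #> k = C" if "C \<in> rcosets M" for C
    proof -
      obtain y where y: "y \<in> carrier G" "C = M #> y" using \<open>C \<in> rcosets M\<close> unfolding RCOSETS_def by blast
      have m: "y \<otimes> k \<otimes> inv y \<in> M" using normal.inv_op_closed2[OF K(1) y(1) k] K(2) by blast
      have "C #> k = (M #> (y \<otimes> k \<otimes> inv y)) #> y"
        using y kC M.subset by (simp add: coset_mult_assoc m_assoc)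
      also have "M #> (y \<otimes> k \<otimes> inv y) = M" by (rule M.rcos_const[OF is_group m])
      finally show ?thesis using y by simp
    qed
    then show "k \<in> N" unfolding N_def using kC by blast
  qed
  ultimately show thesis by (rule that)
qed

lemma card_subgroup_dvd:
  assumes "finite (carrier G)" "subgroup H G"
  shows "card H dvd card (carrier G)"
  using lagrange[OF assms(2)] assms unfolding order_def by (metis dvd_triv_right)

lemma card_rcosets_eq:
  assumes "finite (carrier G)" "subgroup H G" "card (carrier G) = n * card H"
  shows "card (rcosets H) = n"
proof -
  have "card (rcosets H) * card H = n * card H"
    using lagrange[OF assms(2)] assms unfolding order_def by simp
  moreover have "card H > 0" using subgroup.finite_imp_card_positive assms by blast
  ultimately show ?thesis by simp
qed

text \<open>For index 2 the core bound reads |G| <= 2! |N|, so the core is already all of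
  \<open>H\<close>.\<close>

lemma index_two_normal:
  assumes fin: "finite (carrier G)" and H: "subgroup H G" and c: "card (carrier G) = 2 * card H"
  shows "H \<lhd> G"
proof -
  obtain N where N: "N \<lhd> G" "N \<subseteq> H" "card (carrier G) \<le> fact (card (rcosets H)) * card N"
    using normal_core[OF fin H] .
  have "card H \<le> card N" using N(3) card_rcosets_eq[OF fin H c] c by simp
  moreover have "finite H" using fin finite_subset subgroup.subset[OF H] by blast
  ultimately have "N = H" using N(2) card_seteq by blast
  then show ?thesis using N by simp
qed

text \<open>The image of \<open>x\<close> in the quotient by \<open>N\<close> has an order dividing
  both \<open>m\<close> and \<open>k\<close>, hence is trivial.\<close>

lemma coprime_index_mem:
  assumes fin: "finite (carrier G)" and N: "N \<lhd> G" and x: "x \<in> carrier G" "x [^] (m::nat) = \<one>"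
    and c: "card (carrier G) = k * card N" "coprime m k"
  shows "x \<in> N"
proof -
  interpret normal N G by fact
  interpret Q: group "G Mod N" by (rule factorgroup_is_group)
  have sg: "subgroup N G" by (rule normal_imp_subgroup[OF N])
  have ord: "order (G Mod N) = k"
    using card_rcosets_eq[OF fin sg c(1)] unfolding order_def FactGroup_def by simp
  have X: "N #> x \<in> carrier (G Mod N)" using x unfolding carrier_FactGroup by blast
  have "(N #> x) [^]\<^bsub>G Mod N\<^esub> m = \<one>\<^bsub>G Mod N\<^esub>"
    using FactGroup_pow[OF x(1), of m] x subset by simp
  then have "Q.ord (N #> x) dvd m" using Q.pow_eq_id[OF X] by simp
  moreover have "Q.ord (N #> x) dvd k" using Q.ord_dvd_group_order[OF X] ord by simp
  ultimately have "Q.ord (N #> x) = 1" using c(2) by (meson coprime_common_divisor_nat)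
  then have "N #> x = N" using Q.ord_eq_1[OF X] by simp
  then show ?thesis using coset_join1 subset x sg by blast
qed

lemma inj_on_mult_disjoint:
  assumes H: "subgroup H G" and K: "subgroup K G" and d: "H \<inter> K = {\<one>}"
  shows "inj_on (\<lambda>(h, k). h \<otimes> k) (H \<times> K)"
proof (rule inj_onI, clarify)
  note HC = subgroup.mem_carrier[OF H] and KC = subgroup.mem_carrier[OF K]
  fix h k h' k' assume a: "h \<in> H" "k \<in> K" "h' \<in> H" "k' \<in> K" "h \<otimes> k = h' \<otimes> k'"
  note c = HC[OF a(1)] HC[OF a(3)] KC[OF a(2)] KC[OF a(4)]
  have e: "inv h' \<otimes> h = k' \<otimes> inv k"
  proof -
    have "inv h' \<otimes> h = inv h' \<otimes> (h \<otimes> k) \<otimes> inv k" using c by (simp add: m_assoc)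
    then show ?thesis unfolding a(5) using c by (simp add: m_assoc inv_cancel_left)
  qed
  have "inv h' \<otimes> h \<in> H"
    using a subgroup.m_closed[OF H] subgroup.m_inv_closed[OF H] by blast
  moreover have "inv h' \<otimes> h \<in> K"
    unfolding e using a subgroup.m_closed[OF K] subgroup.m_inv_closed[OF K] by blast
  ultimately have "inv h' \<otimes> h = \<one>" using d by blast
  then have "h = h'" using c by (metis inv_closed inv_equality inv_inv)
  then show "h = h' \<and> k = k'" using a(5) c by simp
qed

text \<open>\<open>H\<close> embeds into the quotient by \<open>N\<close>. The divisibility serves
  as an obstruction: it shows that certain small subgroups must meet \<open>N\<close>.\<close>

lemma set_mult_disjoint_normal:
  assumes fin: "finite (carrier G)" and N: "N \<lhd> G" and H: "subgroup H G" and d: "H \<inter> N = {\<one>}"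
  shows "subgroup (H <#> N) G" "card (H <#> N) = card H * card N"
    "card H * card N dvd card (carrier G)"
proof -
  have sg: "subgroup N G" by (rule normal_imp_subgroup[OF N])
  show s: "subgroup (H <#> N) G"
    using mult_norm_subgroup[OF N H] commut_normal[OF H N] by simp
  have inj: "inj_on (\<lambda>(h, n). h \<otimes> n) (H \<times> N)"
    by (rule inj_on_mult_disjoint[OF H sg d])
  have "H <#> N = (\<lambda>(h, n). h \<otimes> n) ` (H \<times> N)" unfolding set_mult_def by auto
  then show cc: "card (H <#> N) = card H * card N"
    using card_image[OF inj] by (simp add: card_cartesian_product)
  show "card H * card N dvd card (carrier G)"
    using card_subgroup_dvd[OF fin s] cc by simp
qed

end

lemma nat_dvd_3: "d dvd (3::nat) \<Longrightarrow> d = 1 \<or> d = 3"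
  using prime_nat_iff[of 3] by simp

lemma coprime_3_8: "coprime (3::nat) 8"
  using coprime_power_right_iff[of "3::nat" 2 3] by simp

lemma card_1_eq_singleton: "card A = 1 \<Longrightarrow> x \<in> A \<Longrightarrow> A = {x}"
  by (erule card_1_singletonE) simp

context group
begin

section \<open>Normalizers, subgroups of order 9, and groups of order 72\<close>

lemma subgroup_conj:
  assumes H: "subgroup H G" and g: "g \<in> carrier G"
  shows "subgroup ((\<lambda>h. g \<otimes> h \<otimes> inv g) ` H) G"
    and "card ((\<lambda>h. g \<otimes> h \<otimes> inv g) ` H) = card H"
proof -
  note HC = subgroup.mem_carrier[OF H]
  show "subgroup ((\<lambda>h. g \<otimes> h \<otimes> inv g) ` H) G"
  proof (rule subgroupI)
    show "(\<lambda>h. g \<otimes> h \<otimes> inv g) ` H \<subseteq> carrier G" using HC g by auto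
    show "(\<lambda>h. g \<otimes> h \<otimes> inv g) ` H \<noteq> {}" using subgroup.one_closed[OF H] by blast
  next
    fix a assume "a \<in> (\<lambda>h. g \<otimes> h \<otimes> inv g) ` H"
    then obtain h where h: "h \<in> H" "a = g \<otimes> h \<otimes> inv g" by blast
    then have "inv a = g \<otimes> inv h \<otimes> inv g" using HC g by (simp add: inv_mult_group m_assoc)
    then show "inv a \<in> (\<lambda>h. g \<otimes> h \<otimes> inv g) ` H" using subgroup.m_inv_closed[OF H h(1)] by blast
  next
    fix a b assume "a \<in> (\<lambda>h. g \<otimes> h \<otimes> inv g) ` H" "b \<in> (\<lambda>h. g \<otimes> h \<otimes> inv g) ` H"
    then obtain h k where h: "h \<in> H" "a = g \<otimes> h \<otimes> inv g" "k \<in> H" "b = g \<otimes> k \<otimes> inv g" by blast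
    then have "a \<otimes> b = g \<otimes> (h \<otimes> k) \<otimes> inv g" using HC g by (simp add: m_assoc inv_cancel_left)
    then show "a \<otimes> b \<in> (\<lambda>h. g \<otimes> h \<otimes> inv g) ` H"
      using subgroup.m_closed[OF H h(1,3)] by blast
  qed
  show "card ((\<lambda>h. g \<otimes> h \<otimes> inv g) ` H) = card H"
    by (rule card_image, rule inj_onI) (use HC g in simp)
qed

text \<open>For finite \<open>K\<close> the one-sided condition defines the normalizer: conjugation
  is injective on \<open>K\<close>, so mapping \<open>K\<close> into itself means mapping it onto
  itself, which gives closure under inverses.\<close>

lemma subgroup_normalizing:
  assumes fin: "finite K" and K: "subgroup K G"
  shows "subgroup {g \<in> carrier G. \<forall>k\<in>K. g \<otimes> k \<otimes> inv g \<in> K} G" (is "subgroup ?N G")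
proof (rule subgroupI)
  note KC = subgroup.mem_carrier[OF K]
  show "?N \<subseteq> carrier G" by blast
  have "\<one> \<in> ?N" using KC by simp
  then show "?N \<noteq> {}" by blast
  show "inv a \<in> ?N" if a: "a \<in> ?N" for a
  proof -
    have ac: "a \<in> carrier G" using a by simp
    have "(\<lambda>k. a \<otimes> k \<otimes> inv a) ` K = K"
    proof (rule endo_inj_surj[OF fin])
      show "(\<lambda>k. a \<otimes> k \<otimes> inv a) ` K \<subseteq> K" using a by blast
      show "inj_on (\<lambda>k. a \<otimes> k \<otimes> inv a) K" by (rule inj_onI) (use KC ac in simp)
    qed
    have "inv a \<otimes> k \<otimes> inv (inv a) \<in> K" if "k \<in> K" for k
    proof -
      obtain h where h: "h \<in> K" "k = a \<otimes> h \<otimes> inv a"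
        using \<open>(\<lambda>k. a \<otimes> k \<otimes> inv a) ` K = K\<close> \<open>k \<in> K\<close> by blast
      then have "inv a \<otimes> k \<otimes> inv (inv a) = h"
        using ac KC by (simp add: m_assoc inv_cancel_left)
      then show ?thesis using h by simp
    qed
    then show ?thesis using ac by blast
  qed
  show "a \<otimes> b \<in> ?N" if ab: "a \<in> ?N" "b \<in> ?N" for a b
  proof -
    have c: "a \<in> carrier G" "b \<in> carrier G" using ab by blast+
    have "a \<otimes> b \<otimes> k \<otimes> inv (a \<otimes> b) \<in> K" if k: "k \<in> K" for k
    proof -
      have "b \<otimes> k \<otimes> inv b \<in> K" using ab(2) k by blast
      then have "a \<otimes> (b \<otimes> k \<otimes> inv b) \<otimes> inv a \<in> K" using ab(1) by blast
      then show ?thesis using c KC[OF k] by (simp add: m_assoc inv_mult_group)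
    qed
    then show ?thesis using c by blast
  qed
qed

lemma finite_subgroup: "finite (carrier G) \<Longrightarrow> subgroup H G \<Longrightarrow> finite H"
  using subgroup.subset finite_subset by blast

lemma subgroup_as_group:
  assumes H: "subgroup H G"
  shows "group (G\<lparr>carrier := H\<rparr>)" and "subgroup K G \<Longrightarrow> K \<subseteq> H \<Longrightarrow> subgroup K (G\<lparr>carrier := H\<rparr>)"
    and "K \<lhd> G\<lparr>carrier := H\<rparr> \<Longrightarrow> h \<in> H \<Longrightarrow> k \<in> K \<Longrightarrow> h \<otimes> k \<otimes> inv h \<in> K"
proof -
  show g: "group (G\<lparr>carrier := H\<rparr>)" by (rule subgroup_imp_group[OF H])
  show "subgroup K G \<Longrightarrow> K \<subseteq> H \<Longrightarrow> subgroup K (G\<lparr>carrier := H\<rparr>)"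
    by (rule subgroup_incl[OF _ H])
  show "h \<otimes> k \<otimes> inv h \<in> K" if "K \<lhd> G\<lparr>carrier := H\<rparr>" "h \<in> H" "k \<in> K"
    using normal.inv_op_closed2[OF that(1), of h k] that m_inv_consistent[OF H] by simp
qed

lemma normal_in_subgroupI:
  assumes H: "subgroup H G" and K: "subgroup K G" "K \<subseteq> H"
    and n: "\<And>h k. h \<in> H \<Longrightarrow> k \<in> K \<Longrightarrow> h \<otimes> k \<otimes> inv h \<in> K"
  shows "K \<lhd> G\<lparr>carrier := H\<rparr>"
  by (rule group.normal_invI[OF subgroup_as_group(1)[OF H] subgroup_as_group(2)[OF H K]])
    (use n m_inv_consistent[OF H] in simp)

lemma card_dvd_subgroup:
  assumes "finite (carrier G)" "subgroup H G" "subgroup K G" "K \<subseteq> H"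
  shows "card K dvd card H"
  using group.card_subgroup_dvd[OF subgroup_as_group(1)[OF assms(2)] _
      subgroup_as_group(2)[OF assms(2-4)]] finite_subgroup[OF assms(1,2)] by simp

lemma coprime_index_mem_subgroup:
  assumes fin: "finite (carrier G)" and H: "subgroup H G" and K: "K \<lhd> G\<lparr>carrier := H\<rparr>"
    and x: "x \<in> H" "x [^] (m::nat) = \<one>" and c: "card H = k * card K" "coprime m k"
  shows "x \<in> K"
proof -
  have "x [^]\<^bsub>G\<lparr>carrier := H\<rparr>\<^esub> m = \<one>" using x(2) by (simp add: nat_pow_consistent[symmetric])
  then show ?thesis
    using group.coprime_index_mem[OF subgroup_as_group(1)[OF H] _ K, of x m k]
      finite_subgroup[OF fin H] x c by simp
qed

lemma pow_card_subgroup: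
  assumes "finite (carrier G)" "subgroup H G" "x \<in> H"
  shows "x [^] card H = \<one>"
proof -
  have "x [^]\<^bsub>G\<lparr>carrier := H\<rparr>\<^esub> order (G\<lparr>carrier := H\<rparr>) = \<one>"
    using group.pow_order_eq_1[OF subgroup_as_group(1)[OF assms(2)], of x] assms by simp
  then show ?thesis by (simp add: order_def nat_pow_consistent[symmetric])
qed

text \<open>The core of \<open>K\<close> in \<open>P\<close> has at least 9/3! elements, so at least
  2, and its order divides 3; hence it equals \<open>K\<close>.\<close>

lemma order_3_normal_in_order_9:
  assumes fin: "finite (carrier G)" and P: "subgroup P G" "card P = 9"
    and K: "subgroup K G" "K \<subseteq> P" "card K = 3"
    and "p \<in> P" "k \<in> K"
  shows "p \<otimes> k \<otimes> inv p \<in> K"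
proof -
  interpret P: group "G\<lparr>carrier := P\<rparr>" by (rule subgroup_as_group(1)[OF P(1)])
  have KP: "subgroup K (G\<lparr>carrier := P\<rparr>)" by (rule subgroup_as_group(2)[OF P(1) K(1,2)])
  have fP: "finite (carrier (G\<lparr>carrier := P\<rparr>))" using finite_subgroup[OF fin P(1)] by simp
  obtain N where N: "N \<lhd> G\<lparr>carrier := P\<rparr>" "N \<subseteq> K"
    "card (carrier (G\<lparr>carrier := P\<rparr>)) \<le> fact (card (rcosets\<^bsub>G\<lparr>carrier := P\<rparr>\<^esub> K)) * card N"
    using P.normal_core[OF fP KP] .
  have "card (rcosets\<^bsub>G\<lparr>carrier := P\<rparr>\<^esub> K) = 3"
    by (rule P.card_rcosets_eq[OF fP KP]) (simp add: P K)
  then have N2: "card N \<ge> 2" using N(3) P(2) by (simp add: fact_numeral)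
  have Ns: "subgroup N G"
    using normal_imp_subgroup[OF N(1)] incl_subgroup[OF P(1)] by blast
  have "card N dvd 3" using card_dvd_subgroup[OF fin K(1) Ns N(2)] K(3) by simp
  then have "card N = 1 \<or> card N = 3" by (rule nat_dvd_3)
  then have "N = K" using N2 N(2) K finite_subgroup[OF fin K(1)] by (intro card_subset_eq) auto
  then show ?thesis using subgroup_as_group(3)[OF P(1) N(1)] assms by blast
qed

text \<open>If the intersection were trivial, the products of an element of \<open>P\<close> with
  one of \<open>Q\<close> would be 81 distinct elements of \<open>G\<close>.\<close>

lemma card_9_subgroups_intersect:
  assumes fin: "finite (carrier G)" and c: "card (carrier G) < 81"
    and P: "subgroup P G" "card P = 9" and Q: "subgroup Q G" "card Q = 9" and ne: "P \<noteq> Q"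
  shows "card (P \<inter> Q) = 3"
proof -
  note PC = subgroup.mem_carrier[OF P(1)] and QC = subgroup.mem_carrier[OF Q(1)]
  have s: "subgroup (P \<inter> Q) G" by (rule subgroups_Inter_pair[OF P(1) Q(1)])
  have "card (P \<inter> Q) dvd 9" using card_dvd_subgroup[OF fin P(1) s] P by simp
  then have "card (P \<inter> Q) dvd 3 ^ 2" by simp
  then obtain i where i: "i \<le> 2" "card (P \<inter> Q) = 3 ^ i"
    using divides_primepow_nat[of 3 _ 2] by auto
  have "i \<noteq> 2"
  proof
    assume "i = 2"
    then have "P \<inter> Q = P" "P \<inter> Q = Q"
      using i P Q finite_subgroup[OF fin P(1)] finite_subgroup[OF fin Q(1)]
      by (simp_all add: card_subset_eq)
    then show False using ne by blast
  qed
  moreover have "i \<noteq> 0"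
  proof
    assume "i = 0"
    then have "card (P \<inter> Q) = 1" using i by simp
    then have t: "P \<inter> Q = {\<one>}" using card_1_eq_singleton[OF _ subgroup.one_closed[OF s]] by blast
    have "inj_on (\<lambda>(p, q). p \<otimes> q) (P \<times> Q)"
      by (rule inj_on_mult_disjoint[OF P(1) Q(1) t])
    then have "card (P \<times> Q) \<le> card (carrier G)"
      by (rule card_inj_on_le) (use PC QC fin in auto)
    then show False using c P Q by (simp add: card_cartesian_product)
  qed
  ultimately have "i = 1" using i by linarith
  then show ?thesis using i by simp
qed

text \<open>If a Sylow 3-subgroup \<open>P\<close> is not normal, it meets a conjugate
  \<open>Q\<close> in a group \<open>K\<close> of order 3, and the normalizer \<open>N\<close> of
  \<open>K\<close> contains \<open>P\<close> and \<open>Q\<close>. Its order is 9 k with k dividing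
  8. Having two subgroups of order 9 excludes k = 1 and k = 2; for k = 8 the group \<open>K\<close>
  is normal. For k = 4 the normalizer has index 2, and a conjugate of \<open>K\<close> other than
  \<open>K\<close> would produce a normal subgroup of order 9 in it.\<close>

lemma order_72_normal_3_subgroup:
  assumes fin: "finite (carrier G)" and c: "card (carrier G) = 72"
  obtains N where "N \<lhd> G" "card N = 9 \<or> card N = 3"
proof -
  have "order G = 3 ^ 2 * 8" using c by (simp add: order_def)
  then obtain P where P: "subgroup P G" "card P = 9"
    using sylow_thm[of 3 G 2 8] fin is_group by auto
  show thesis
  proof (cases "P \<lhd> G")
    case True
    then show ?thesis using that P by blast
  next
    case False
    then obtain x h where xh: "x \<in> carrier G" "h \<in> P" "x \<otimes> h \<otimes> inv x \<notin> P"
      by (meson normal_invI[OF P(1)])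
    define Q where "Q = (\<lambda>h. x \<otimes> h \<otimes> inv x) ` P"
    have Q: "subgroup Q G" "card Q = 9" unfolding Q_def using subgroup_conj[OF P(1) xh(1)] P by auto
    have ne: "P \<noteq> Q" using xh Q_def by blast
    define K where "K = P \<inter> Q"
    have K: "card K = 3" unfolding K_def
      by (rule card_9_subgroups_intersect[OF fin _ P Q ne]) (simp add: c)
    have Ks: "subgroup K G" unfolding K_def by (rule subgroups_Inter_pair[OF P(1) Q(1)])
    have KC: "K \<subseteq> carrier G" by (rule subgroup.subset[OF Ks])
    define N where "N = {g \<in> carrier G. \<forall>k\<in>K. g \<otimes> k \<otimes> inv g \<in> K}"
    have Ns: "subgroup N G" unfolding N_def
      by (rule subgroup_normalizing[OF finite_subgroup[OF fin Ks] Ks])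
    have PN: "P \<subseteq> N"
    proof
      fix p assume p: "p \<in> P"
      have "K \<subseteq> P" using K_def by simp
      from order_3_normal_in_order_9[OF fin P Ks this K p] show "p \<in> N"
        unfolding N_def using subgroup.mem_carrier[OF P(1) p] by simp
    qed
    have QN: "Q \<subseteq> N"
    proof
      fix p assume p: "p \<in> Q"
      have "K \<subseteq> Q" using K_def by simp
      from order_3_normal_in_order_9[OF fin Q Ks this K p] show "p \<in> N"
        unfolding N_def using subgroup.mem_carrier[OF Q(1) p] by simp
    qed
    \<comment> \<open>A normal subgroup of \<open>N\<close> of order 9 and index prime to 3 absorbs
      all elements of \<open>P\<close> and \<open>Q\<close>, forcing \<open>P = Q\<close>.\<close>
    have unique: False if R: "R \<lhd> G\<lparr>carrier := N\<rparr>" "card R = 9"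
      and k: "card N = k * 9" "coprime 9 k" for R k
    proof -
      have "p \<in> R" if "p \<in> P \<union> Q" for p
      proof (rule coprime_index_mem_subgroup[OF fin Ns R(1)])
        show "p [^] (9::nat) = \<one>" using pow_card_subgroup[OF fin P(1)] pow_card_subgroup[OF fin Q(1)] P Q that by auto
        show "p \<in> N" using that PN QN by blast
      qed (use R k in auto)
      moreover have "finite R" using R(2) card.infinite by fastforce
      ultimately have "P = R" "Q = R" using P Q R by (simp_all add: card_subset_eq subset_iff)
      then show False using ne by blast
    qed
    have "9 dvd card N" using card_dvd_subgroup[OF fin Ns P(1) PN] P by simp
    then obtain k where k: "card N = 9 * k" by blast
    have "9 * k dvd 9 * 8" using card_subgroup_dvd[OF fin Ns] c k by simp
    then have "k dvd 2 ^ 3" by simp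
    then obtain i where i: "i \<le> 3" "k = 2 ^ i"
      using divides_primepow_nat[of 2 k 3] by auto
    have cop: "coprime 9 k" unfolding i(2) by simp
    have kN: "k = 1 \<or> k = 2 \<or> k = 4 \<or> k = 8"
    proof -
      have "i = 0 \<or> i = 1 \<or> i = 2 \<or> i = 3" using i by linarith
      then show ?thesis using i(2) by auto
    qed
    have k12: "k \<noteq> 1" "k \<noteq> 2"
    proof -
      show "k \<noteq> 1"
      proof
        assume "k = 1"
        then have "P = N" "Q = N" using PN QN P Q k finite_subgroup[OF fin Ns]
          by (simp_all add: card_subset_eq)
        then show False using ne by blast
      qed
      show "k \<noteq> 2"
      proof
        assume "k = 2"
        then have "P \<lhd> G\<lparr>carrier := N\<rparr>"
          using group.index_two_normal[OF subgroup_as_group(1)[OF Ns] _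
              subgroup_as_group(2)[OF Ns P(1) PN]] finite_subgroup[OF fin Ns] k P by simp
        then show False using unique[OF _ P(2), of k] k cop by simp
      qed
    qed
    have "K \<lhd> G"
    proof (cases "k = 8")
      case True
      then have "N = carrier G" using k c N_def fin by (intro card_subset_eq) auto
      then show ?thesis by (intro normal_invI[OF Ks]) (use N_def in blast)
    next
      case False
      then have k4: "k = 4" using kN k12 by blast
      have Nn: "N \<lhd> G" by (rule index_two_normal[OF fin Ns]) (simp add: k k4 c)
      show ?thesis
      proof (rule ccontr)
        assume "\<not> K \<lhd> G"
        then obtain y h where yh: "y \<in> carrier G" "h \<in> K" "y \<otimes> h \<otimes> inv y \<notin> K"
          by (meson normal_invI[OF Ks])
        define L where "L = (\<lambda>h. y \<otimes> h \<otimes> inv y) ` K"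
        have L: "subgroup L G" "card L = 3"
          unfolding L_def using subgroup_conj[OF Ks yh(1)] K by auto
        have KN: "K \<subseteq> N" using PN K_def by blast
        have LN: "L \<subseteq> N" unfolding L_def
          using KN normal.inv_op_closed2[OF Nn yh(1)] by blast
        \<comment> \<open>\<open>N\<close> is normal in \<open>G\<close>, so conjugating by
          \<open>y\<close> maps \<open>N\<close> to itself and carries normality of \<open>K\<close>
          in \<open>N\<close> over to \<open>L\<close>.\<close>
        have Ln: "n \<otimes> l \<otimes> inv n \<in> L" if n: "n \<in> N" and l: "l \<in> L" for n l
        proof -
          obtain k where k: "k \<in> K" "l = y \<otimes> k \<otimes> inv y" using l L_def by blast
          have nC: "n \<in> carrier G" using n N_def by simp
          have kC: "k \<in> carrier G" using k KC by blast
          define m where "m = inv y \<otimes> n \<otimes> y"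
          have "m \<in> N" unfolding m_def using normal.inv_op_closed1[OF Nn yh(1) n] .
          then have "m \<otimes> k \<otimes> inv m \<in> K" using k N_def by blast
          moreover have "n \<otimes> l \<otimes> inv n = y \<otimes> (m \<otimes> k \<otimes> inv m) \<otimes> inv y"
            unfolding m_def k(2) using nC kC yh(1)
            by (simp add: m_assoc inv_mult_group inv_cancel_left)
          ultimately show ?thesis unfolding L_def by blast
        qed
        have KL: "K \<inter> L = {\<one>}"
        proof -
          have s: "subgroup (K \<inter> L) G" by (rule subgroups_Inter_pair[OF Ks L(1)])
          have "card (K \<inter> L) dvd 3" using card_dvd_subgroup[OF fin Ks s] K by simp
          then have "card (K \<inter> L) = 1 \<or> card (K \<inter> L) = 3" by (rule nat_dvd_3)
          moreover have "card (K \<inter> L) \<noteq> 3"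
          proof
            assume "card (K \<inter> L) = 3"
            then have "K \<inter> L = K" "K \<inter> L = L"
              using K L finite_subgroup[OF fin Ks] finite_subgroup[OF fin L(1)]
              by (simp_all add: card_subset_eq)
            then have "K = L" by blast
            then show False using yh L_def by blast
          qed
          ultimately have "card (K \<inter> L) = 1" by simp
          then show ?thesis using card_1_eq_singleton[OF _ subgroup.one_closed[OF s]] by blast
        qed
        interpret N: group "G\<lparr>carrier := N\<rparr>" by (rule subgroup_as_group(1)[OF Ns])
        have Kn: "K \<lhd> G\<lparr>carrier := N\<rparr>"
          by (rule normal_in_subgroupI[OF Ns Ks KN]) (simp add: N_def)
        have Ln: "L \<lhd> G\<lparr>carrier := N\<rparr>"
          by (rule normal_in_subgroupI[OF Ns L(1) LN Ln])
        have fN: "finite (carrier (G\<lparr>carrier := N\<rparr>))" using finite_subgroup[OF fin Ns] by simp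
        define R where "R = K <#> L"
        have "card R = 9"
          using N.set_mult_disjoint_normal(2)[OF fN Ln normal_imp_subgroup[OF Kn]] KL K L R_def
          by simp
        moreover have "R \<lhd> G\<lparr>carrier := N\<rparr>"
        proof (rule N.normal_invI)
          show "subgroup R (G\<lparr>carrier := N\<rparr>)"
            using N.set_mult_disjoint_normal(1)[OF fN Ln normal_imp_subgroup[OF Kn]] KL R_def by simp
        next
          fix n r assume nr: "n \<in> carrier (G\<lparr>carrier := N\<rparr>)" "r \<in> R"
          then obtain a b where ab: "a \<in> K" "b \<in> L" "r = a \<otimes> b"
            unfolding R_def set_mult_def by blast
          have c: "n \<in> carrier G" "a \<in> carrier G" "b \<in> carrier G"
            using nr ab KC subgroup.subset[OF L(1)] subgroup.subset[OF Ns] by auto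
          have "n \<otimes> r \<otimes> inv n = (n \<otimes> a \<otimes> inv n) \<otimes> (n \<otimes> b \<otimes> inv n)"
            using c ab by (simp add: m_assoc inv_cancel_left)
          moreover have "n \<otimes> a \<otimes> inv n \<in> K" "n \<otimes> b \<otimes> inv n \<in> L"
            using subgroup_as_group(3)[OF Ns] Kn Ln nr ab by auto
          ultimately show "n \<otimes>\<^bsub>G\<lparr>carrier := N\<rparr>\<^esub> r \<otimes>\<^bsub>G\<lparr>carrier := N\<rparr>\<^esub> inv\<^bsub>G\<lparr>carrier := N\<rparr>\<^esub> n \<in> R"
            using nr m_inv_consistent[OF Ns] unfolding R_def set_mult_def by auto
        qed
        ultimately show False using unique[of R k] k cop by simp
      qed
    qed
    then show ?thesis using that K by blast
  qed
qed

section \<open>Explicit small subgroups and the action on a normal subgroup of order 3\<close>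

lemma subgroup_pair:
  assumes "a \<in> carrier G" "a \<otimes> a = \<one>"
  shows "subgroup {\<one>, a} G"
proof (rule subgroupI)
  have "inv a = a" using assms by (intro inv_equality) auto
  then show "\<And>b. b \<in> {\<one>, a} \<Longrightarrow> inv b \<in> {\<one>, a}" by auto
qed (use assms in auto)

lemma subgroup_klein:
  assumes a: "a \<in> carrier G" "a \<otimes> a = \<one>" and b: "b \<in> carrier G" "b \<otimes> b = \<one>"
    and ab: "a \<otimes> b = b \<otimes> a"
  shows "subgroup {\<one>, a, b, a \<otimes> b} G"
proof (rule subgroupI)
  have za: "a \<otimes> (a \<otimes> z) = z" if "z \<in> carrier G" for z
    using a that by (simp add: m_assoc[symmetric])
  have zb: "b \<otimes> (b \<otimes> z) = z" if "z \<in> carrier G" for z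
    using b that by (simp add: m_assoc[symmetric])
  have zab: "b \<otimes> (a \<otimes> z) = a \<otimes> (b \<otimes> z)" if "z \<in> carrier G" for z
    using a b that ab by (simp add: m_assoc[symmetric])
  have i: "inv a = a" "inv b = b" using a b by (auto intro: inv_equality)
  show "\<And>u. u \<in> {\<one>, a, b, a \<otimes> b} \<Longrightarrow> inv u \<in> {\<one>, a, b, a \<otimes> b}"
    using a b i ab by (auto simp: inv_mult_group)
  show "u \<otimes> v \<in> {\<one>, a, b, a \<otimes> b}" if "u \<in> {\<one>, a, b, a \<otimes> b}" "v \<in> {\<one>, a, b, a \<otimes> b}" for u v
    using that a b ab[symmetric] by (auto simp: m_assoc za zb zab)
qed (use a b in auto)

lemma subgroup_order_3:
  assumes y: "y \<in> carrier G" "y \<otimes> (y \<otimes> y) = \<one>" "y \<noteq> \<one>"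
  shows "subgroup {\<one>, y, y \<otimes> y} G" and "card {\<one>, y, y \<otimes> y} = 3"
proof -
  have z: "y \<otimes> (y \<otimes> (y \<otimes> z)) = z" if "z \<in> carrier G" for z
  proof -
    have "y \<otimes> (y \<otimes> (y \<otimes> z)) = y \<otimes> (y \<otimes> y) \<otimes> z" using that y(1) by (simp add: m_assoc)
    then show ?thesis using y that by simp
  qed
  have i: "inv y = y \<otimes> y" using y by (intro inv_equality) (auto simp: m_assoc)
  show "subgroup {\<one>, y, y \<otimes> y} G"
  proof (rule subgroupI)
    show "\<And>u. u \<in> {\<one>, y, y \<otimes> y} \<Longrightarrow> inv u \<in> {\<one>, y, y \<otimes> y}"
      using y i by (auto simp: inv_mult_group m_assoc z)
    show "u \<otimes> w \<in> {\<one>, y, y \<otimes> y}" if "u \<in> {\<one>, y, y \<otimes> y}" "w \<in> {\<one>, y, y \<otimes> y}" for u w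
      using that y by (auto simp: m_assoc z)
  qed (use y in auto)
  have "y \<otimes> y \<noteq> \<one>" using y by auto
  moreover have "y \<otimes> y \<noteq> y" using y by simp
  ultimately show "card {\<one>, y, y \<otimes> y} = 3" using y(3) by auto
qed

lemma generate_subgroup_eq: "subgroup H G \<Longrightarrow> generate G H = H"
  by (simp add: generate_subgroup_incl generate.incl subset_antisym subsetI)

lemma card_insert_normal_le:
  assumes fin: "finite (carrier G)" and N: "N \<lhd> G" and t: "t \<in> carrier G"
    and n: "0 < n" "t [^] (n::nat) = \<one>"
  shows "card (generate G (insert t N)) \<le> n * card N"
proof -
  have Ns: "subgroup N G" by (rule normal_imp_subgroup[OF N])
  have "card (generate G (insert t N)) \<le> n * card (generate G N)"
    by (rule card_generate_insert_le[OF fin subgroup.subset[OF Ns] t n])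
      (simp add: generate_subgroup_eq[OF Ns] normal.inv_op_closed2[OF N t])
  then show ?thesis by (simp add: generate_subgroup_eq[OF Ns])
qed

text \<open>The only nontrivial automorphism of a group of order 3 is inversion. If \<open>x\<close>
  acted by inversion, so would its cube, which is the identity.\<close>

lemma order_3_centralizes_normal_order_3:
  assumes fin: "finite (carrier G)" and K: "K \<lhd> G" "card K = 3"
    and x: "x \<in> carrier G" "x \<otimes> (x \<otimes> x) = \<one>" and k: "k \<in> K"
  shows "x \<otimes> k \<otimes> inv x = k"
proof (cases "k = \<one>")
  case True
  then show ?thesis using x by simp
next
  case False
  have Ks: "subgroup K G" by (rule normal_imp_subgroup[OF K(1)])
  have kC: "k \<in> carrier G" using k subgroup.mem_carrier[OF Ks] by blast
  have k3: "k \<otimes> (k \<otimes> k) = \<one>"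
    using pow_card_subgroup[OF fin Ks k] K(2) kC by (simp add: numeral_3_eq_3 m_assoc)
  have ik: "inv k = k \<otimes> k" using k3 kC by (intro inv_equality) (auto simp: m_assoc)
  have ne: "k \<noteq> inv k"
  proof
    assume "k = inv k"
    then have "k \<otimes> k = k" using ik by simp
    then show False using kC False by simp
  qed
  have "inv k \<noteq> \<one>" using False kC by simp
  then have "card {\<one>, k, inv k} = 3" using False ne by simp
  moreover have "{\<one>, k, inv k} \<subseteq> K"
    using k subgroup.one_closed[OF Ks] subgroup.m_inv_closed[OF Ks] by blast
  ultimately have KE: "K = {\<one>, k, inv k}"
    using K(2) finite_subgroup[OF fin Ks] by (metis card_subset_eq)
  have "x \<otimes> k \<otimes> inv x \<in> K" by (rule normal.inv_op_closed2[OF K(1) x(1) k])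
  moreover have "x \<otimes> k \<otimes> inv x \<noteq> \<one>"
  proof
    assume "x \<otimes> k \<otimes> inv x = \<one>"
    then have "inv x \<otimes> (x \<otimes> k \<otimes> inv x) \<otimes> x = \<one>" using x by simp
    then show False using x kC False by (simp add: m_assoc inv_cancel_left)
  qed
  moreover have "x \<otimes> k \<otimes> inv x \<noteq> inv k"
  proof
    assume e: "x \<otimes> k \<otimes> inv x = inv k"
    have e': "x \<otimes> inv k \<otimes> inv x = k"
    proof -
      have "x \<otimes> inv k \<otimes> inv x = inv (x \<otimes> k \<otimes> inv x)"
        using x kC by (simp add: inv_mult_group m_assoc)
      then show ?thesis using e kC by simp
    qed
    have "k = (x \<otimes> (x \<otimes> x)) \<otimes> k \<otimes> inv (x \<otimes> (x \<otimes> x))" unfolding x(2) using kC by simp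
    also have "\<dots> = x \<otimes> (x \<otimes> (x \<otimes> k \<otimes> inv x) \<otimes> inv x) \<otimes> inv x"
      using x(1) kC by (simp add: m_assoc inv_mult_group)
    also have "\<dots> = inv k" by (simp only: e e')
    finally show False using ne by simp
  qed
  ultimately show ?thesis using KE by blast
qed

lemma coprime_card_Int_trivial:
  assumes fin: "finite (carrier G)" and H: "subgroup H G" and K: "subgroup K G"
    and c: "coprime (card H) (card K)"
  shows "H \<inter> K = {\<one>}"
proof -
  have s: "subgroup (H \<inter> K) G" by (rule subgroups_Inter_pair[OF H K])
  have "card (H \<inter> K) dvd card H" "card (H \<inter> K) dvd card K"
    using card_dvd_subgroup[OF fin H s] card_dvd_subgroup[OF fin K s] by auto
  then have "card (H \<inter> K) = 1" using c by (meson coprime_common_divisor_nat)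
  then show ?thesis using card_1_eq_singleton[OF _ subgroup.one_closed[OF s]] by blast
qed

end

subsection \<open>Amalgams of \<open>D\<^sub>3\<close> and \<open>D\<^sub>2\<close>\<close>

text \<open>Finite quotients of the amalgam of \<open>D\<^sub>3 = \<langle>a, x\<rangle>\<close> and \<open>D\<^sub>2 = \<langle>a, c\<rangle>\<close> over \<open>\<langle>a\<rangle>\<close>.\<close>

locale D3_D2_amalgam = group G for G (structure) +
  fixes a x c
  assumes fin: "finite (carrier G)"
    and ca [simp]: "a \<in> carrier G" and cx [simp]: "x \<in> carrier G" and cc [simp]: "c \<in> carrier G"
    and aa: "a \<otimes> a = \<one>" and c2: "c \<otimes> c = \<one>" and x3: "x \<otimes> (x \<otimes> x) = \<one>"
    and ac: "a \<otimes> c = c \<otimes> a" and ax: "a \<otimes> x = x \<otimes> (x \<otimes> a)"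
    and gen: "generate G {a, x, c} = carrier G"
begin

text \<open>Every relation is restated with a tail \<open>z\<close>, so that right-associated words
  can be rewritten inside. The orientation moves \<open>a\<close> to the right past \<open>c\<close>
  and \<open>x\<close>; words end up as words in \<open>x\<close> and \<open>c\<close> followed by
  at most one \<open>a\<close>.\<close>

lemma rels:
  assumes "z \<in> carrier G"
  shows "a \<otimes> (a \<otimes> z) = z" "c \<otimes> (c \<otimes> z) = z" "x \<otimes> (x \<otimes> (x \<otimes> z)) = z"
    "a \<otimes> (c \<otimes> z) = c \<otimes> (a \<otimes> z)" "a \<otimes> (x \<otimes> z) = x \<otimes> (x \<otimes> (a \<otimes> z))"
proof -
  show "a \<otimes> (a \<otimes> z) = z" "c \<otimes> (c \<otimes> z) = z" "a \<otimes> (c \<otimes> z) = c \<otimes> (a \<otimes> z)"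
    using assms by (simp_all add: m_assoc[symmetric] aa c2 ac)
  have "x \<otimes> (x \<otimes> (x \<otimes> z)) = x \<otimes> (x \<otimes> x) \<otimes> z" using assms by (simp add: m_assoc)
  then show "x \<otimes> (x \<otimes> (x \<otimes> z)) = z" using x3 assms by simp
  have "a \<otimes> (x \<otimes> z) = a \<otimes> x \<otimes> z" using assms by (simp add: m_assoc)
  then show "a \<otimes> (x \<otimes> z) = x \<otimes> (x \<otimes> (a \<otimes> z))" unfolding ax using assms by (simp add: m_assoc)
qed

lemma invs: "inv a = a" "inv c = c" "inv x = x \<otimes> x"
  by (rule inv_equality; simp add: aa c2 x3 m_assoc)+

lemmas word_simps = m_assoc rels aa c2 x3 ac ax invs

definition c\<^sub>1 where "c\<^sub>1 = x \<otimes> c \<otimes> inv x"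
definition c\<^sub>2 where "c\<^sub>2 = x \<otimes> c\<^sub>1 \<otimes> inv x"

lemma c1_c2_closed [simp]: "c\<^sub>1 \<in> carrier G" "c\<^sub>2 \<in> carrier G"
  by (simp_all add: c\<^sub>1_def c\<^sub>2_def)

lemma conj_x: "x \<otimes> c \<otimes> inv x = c\<^sub>1" "x \<otimes> c\<^sub>1 \<otimes> inv x = c\<^sub>2" "x \<otimes> c\<^sub>2 \<otimes> inv x = c"
  by (simp_all add: c\<^sub>1_def c\<^sub>2_def word_simps)

text \<open>\<open>a\<close> commutes with \<open>c\<close> and inverts \<open>x\<close>, so it
  exchanges the conjugates of \<open>c\<close> by \<open>x\<close> and by its inverse. With the
  cyclic action of \<open>x\<close>, this makes the subgroup generated by the three conjugates
  normal.\<close>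

lemma conj_a: "a \<otimes> c \<otimes> inv a = c" "a \<otimes> c\<^sub>1 \<otimes> inv a = c\<^sub>2" "a \<otimes> c\<^sub>2 \<otimes> inv a = c\<^sub>1"
  by (simp_all add: c\<^sub>1_def c\<^sub>2_def word_simps)

lemma c1_c2_sq: "c\<^sub>1 \<otimes> c\<^sub>1 = \<one>" "c\<^sub>2 \<otimes> c\<^sub>2 = \<one>"
  by (simp_all add: c\<^sub>1_def c\<^sub>2_def word_simps)

lemma conj_x_mult:
  assumes "u \<in> carrier G" "v \<in> carrier G"
  shows "x \<otimes> (u \<otimes> v) \<otimes> inv x = (x \<otimes> u \<otimes> inv x) \<otimes> (x \<otimes> v \<otimes> inv x)"
  using assms by (simp add: m_assoc inv_cancel_left)

definition W where "W = generate G {c, c\<^sub>1, c\<^sub>2}"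

lemma subgroup_W: "subgroup W G"
  unfolding W_def by (rule generate_is_subgroup) simp

lemma W_mem: "c \<in> W" "c\<^sub>1 \<in> W" "c\<^sub>2 \<in> W"
  unfolding W_def by (auto intro: generate.incl)

text \<open>The quotient by \<open>W\<close> is a quotient of the dihedral group of order 6:
  adjoining \<open>x\<close> to \<open>W\<close> costs a factor of at most 3, then adjoining
  \<open>a\<close> a factor of at most 2.\<close>

lemma card_le_W: "card (carrier G) \<le> 6 * card W"
proof -
  let ?S = "{c, c\<^sub>1, c\<^sub>2}"
  have "card (generate G (insert x ?S)) \<le> 3 * card (generate G ?S)"
    by (rule card_generate_insert_le[OF fin])
      (auto simp: numeral_3_eq_3 m_assoc x3 conj_x[unfolded m_assoc] conj_x intro: generate.incl)
  moreover have "card (generate G (insert a (insert x ?S))) \<le> 2 * card (generate G (insert x ?S))"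
  proof (rule card_generate_insert_le[OF fin])
    fix h assume "h \<in> insert x ?S"
    moreover have "a \<otimes> x \<otimes> inv a = x \<otimes> x" by (simp add: word_simps)
    moreover have "x \<otimes> x \<in> generate G (insert x ?S)" by (auto intro: generate.intros)
    ultimately show "a \<otimes> h \<otimes> inv a \<in> generate G (insert x ?S)"
      using conj_a by (auto intro: generate.incl)
  qed (auto simp: numeral_2_eq_2 aa)
  moreover have "generate G (insert a (insert x ?S)) = carrier G"
  proof
    show "generate G (insert a (insert x ?S)) \<subseteq> carrier G" by (rule generate_incl) simp
    have "{a, x, c} \<subseteq> insert a (insert x ?S)" by blast
    from mono_generate[OF this] show "carrier G \<subseteq> generate G (insert a (insert x ?S))"
      using gen by simp
  qed
  ultimately show ?thesis unfolding W_def by simp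
qed

text \<open>Normality puts all conjugates of \<open>c\<close> into \<open>N\<close>, and the bound
  by 6 |W| leaves no room between \<open>W\<close> and \<open>N\<close>.\<close>

lemma W_eq_normal:
  assumes N: "N \<lhd> G" "card (carrier G) = 6 * card N" "c \<in> N"
  shows "W = N"
proof (rule card_seteq)
  have Ns: "subgroup N G" by (rule normal_imp_subgroup[OF N(1)])
  show "finite N" by (rule finite_subgroup[OF fin Ns])
  have "c\<^sub>1 \<in> N" unfolding c\<^sub>1_def by (rule normal.inv_op_closed2[OF N(1) cx N(3)])
  moreover from this have "c\<^sub>2 \<in> N" unfolding c\<^sub>2_def by (rule normal.inv_op_closed2[OF N(1) cx])
  ultimately show "W \<subseteq> N" unfolding W_def using generate_subgroup_incl[OF _ Ns] N(3) by simp
  show "card N \<le> card W" using card_le_W N(2) by simp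
qed

text \<open>With \<open>j\<close> the index of the core \<open>N\<close> in \<open>M\<close>, the
  core bound gives 3 j <= 6. The involution \<open>a\<close> survives modulo \<open>N\<close>, so 3
  j is even and j = 2. The maximality clause is passed on because for order 72 the core must be
  known to contain the normal subgroup of order 3.\<close>

lemma index_six_core:
  assumes M: "subgroup M G" "card (carrier G) = 3 * card M"
  obtains N where "N \<lhd> G" "card (carrier G) = 6 * card N" "c \<in> N \<or> a \<otimes> c \<in> N"
    "\<And>K. K \<lhd> G \<Longrightarrow> K \<subseteq> M \<Longrightarrow> K \<subseteq> N"
proof -
  obtain N where N: "N \<lhd> G" "N \<subseteq> M" "card (carrier G) \<le> fact (card (rcosets M)) * card N"
    and max: "\<And>K. K \<lhd> G \<Longrightarrow> K \<subseteq> M \<Longrightarrow> K \<subseteq> N"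
    by (rule normal_core[OF fin M(1)]) blast
  have Ns: "subgroup N G" by (rule normal_imp_subgroup[OF N(1)])
  have pos: "card N > 0" using subgroup.finite_imp_card_positive[OF Ns fin] .
  have le: "card (carrier G) \<le> 6 * card N"
    using N(3) card_rcosets_eq[OF fin M] by (simp add: fact_numeral)
  obtain j where j: "card M = card N * j"
    using card_dvd_subgroup[OF fin M(1) Ns N(2)] by blast
  have j12: "j = 1 \<or> j = 2"
  proof -
    have "card N * (3 * j) \<le> card N * 6" using le j M(2) by (simp add: mult.commute mult.left_commute)
    then have "j \<le> 2" using pos by simp
    moreover have "j \<noteq> 0" using j subgroup.finite_imp_card_positive[OF M(1) fin] by auto
    ultimately show ?thesis by linarith
  qed
  \<comment> \<open>If \<open>a\<close> lies in \<open>N\<close>, so does the product of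
    \<open>a\<close> with its conjugate by \<open>x\<close>, which is \<open>x\<close>. Then
    \<open>c\<close> and \<open>N\<close> generate \<open>G\<close>, so |G| <= 2 |N|, against |G| =
    3 j |N|.\<close>
  have aN: "a \<notin> N"
  proof
    assume a: "a \<in> N"
    have "a \<otimes> (x \<otimes> a \<otimes> inv x) \<in> N"
      using a normal.inv_op_closed2[OF N(1) cx a] subgroup.m_closed[OF Ns] by blast
    moreover have "a \<otimes> (x \<otimes> a \<otimes> inv x) = x" by (simp add: word_simps)
    ultimately have x: "x \<in> N" by simp
    have "{a, x, c} \<subseteq> insert c N" using a x by blast
    from mono_generate[OF this] have "card (carrier G) \<le> card (generate G (insert c N))"
      using gen generate_in_carrier[of "insert c N"] subgroup.subset[OF Ns]
      by (intro card_mono finite_subset[OF _ fin]) auto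
    also have "\<dots> \<le> 2 * card N"
      by (rule card_insert_normal_le[OF fin N(1) cc]) (simp_all add: numeral_2_eq_2 c2)
    finally show False using pos j j12 M(2) by auto
  qed
  have "{\<one>, a} \<inter> N = {\<one>}" using aN subgroup.one_closed[OF Ns] by auto
  from set_mult_disjoint_normal(3)[OF fin N(1) subgroup_pair[OF ca aa] this]
  have "card {\<one>, a} * card N dvd card (carrier G)" .
  moreover have "card {\<one>, a} = 2" using aN subgroup.one_closed[OF Ns] by (auto simp: card_insert_if)
  ultimately have "card N * 2 dvd card N * (3 * j)"
    unfolding M(2) j by (simp only: mult.commute mult.left_commute)
  then have "2 dvd 3 * j" using pos by (simp only: nat_mult_dvd_cancel_disj) simp
  then have j2: "j = 2" using j12 by auto
  then have c6: "card (carrier G) = 6 * card N" using M(2) j by simp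
  have "c \<in> N \<or> a \<otimes> c \<in> N"
  proof (rule ccontr)
    \<comment> \<open>Otherwise the Klein four-group would embed into a quotient of order 6.\<close>
    assume n: "\<not> (c \<in> N \<or> a \<otimes> c \<in> N)"
    have "{\<one>, a, c, a \<otimes> c} \<inter> N = {\<one>}" using n aN subgroup.one_closed[OF Ns] by auto
    moreover have "card {\<one>, a, c, a \<otimes> c} = 4"
    proof -
      have "\<one> \<noteq> a" "\<one> \<noteq> c" "\<one> \<noteq> a \<otimes> c" using n aN subgroup.one_closed[OF Ns] by auto
      moreover from this have "a \<noteq> c" "a \<noteq> a \<otimes> c" "c \<noteq> a \<otimes> c" using aa by auto
      ultimately show ?thesis by simp
    qed
    ultimately have "4 * card N dvd card (carrier G)"
      using set_mult_disjoint_normal(3)[OF fin N(1) subgroup_klein[OF ca aa cc c2 ac]] by simp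
    then have "4 * card N dvd 6 * card N" using c6 by simp
    then show False using pos by simp
  qed
  then show thesis using that N(1) c6 max by blast
qed

text \<open>\<open>a c\<close> is another involution of \<open>V\<close> commuting with
  \<open>a\<close>, and \<open>a\<close> times it gives back \<open>c\<close>. This reduces the
  alternative \<open>a c\<close> in the core to the alternative \<open>c\<close> in the
  core.\<close>

lemma D3_D2_amalgam_ac: "D3_D2_amalgam G a x (a \<otimes> c)"
proof
  show "generate G {a, x, a \<otimes> c} = carrier G"
  proof
    show "generate G {a, x, a \<otimes> c} \<subseteq> carrier G" by (rule generate_incl) simp
    have s: "subgroup (generate G {a, x, a \<otimes> c}) G" by (rule generate_is_subgroup) simp
    have m: "a \<in> generate G {a, x, a \<otimes> c}" "x \<in> generate G {a, x, a \<otimes> c}"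
      "a \<otimes> c \<in> generate G {a, x, a \<otimes> c}" by (auto intro: generate.incl)
    have "a \<otimes> (a \<otimes> c) = c" by (simp add: word_simps)
    then have "c \<in> generate G {a, x, a \<otimes> c}" using subgroup.m_closed[OF s m(1,3)] by simp
    then show "carrier G \<subseteq> generate G {a, x, a \<otimes> c}"
      using generate_subgroup_incl[OF _ s, of "{a, x, c}"] m gen by simp
  qed
qed (auto simp: fin word_simps)

lemma x_pow_3: "x [^] (3::nat) = \<one>"
  by (simp add: numeral_3_eq_3 m_assoc x3)

lemma c_sq_cancel:
  assumes "z \<in> carrier G"
  shows "c\<^sub>1 \<otimes> (c\<^sub>1 \<otimes> z) = z" "c\<^sub>2 \<otimes> (c\<^sub>2 \<otimes> z) = z"
  using assms c1_c2_sq by (simp_all add: m_assoc[symmetric])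

lemma inv_c: "inv c\<^sub>1 = c\<^sub>1" "inv c\<^sub>2 = c\<^sub>2"
  using c1_c2_sq by (auto intro: inv_equality)

lemma commute_rotate:
  assumes "c\<^sub>1 \<otimes> c\<^sub>2 = c\<^sub>2 \<otimes> c\<^sub>1"
  shows "c \<otimes> c\<^sub>1 = c\<^sub>1 \<otimes> c"
proof -
  have e: "c \<otimes> c\<^sub>2 = c\<^sub>2 \<otimes> c"
    using arg_cong[OF assms, of "\<lambda>u. x \<otimes> u \<otimes> inv x"]
    by (simp add: conj_x_mult conj_x)
  show ?thesis
    using arg_cong[OF e, of "\<lambda>u. x \<otimes> u \<otimes> inv x"]
    by (simp add: conj_x_mult conj_x)
qed

text \<open>If \<open>c\<close> and \<open>c\<^sub>1\<close> did not commute, \<open>W\<close> would be dihedral of order 8, whose only elements of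
  order 4 are \<open>y = c c\<^sub>1\<close> and \<open>y\<inverse>\<close>; the conjugate \<open>c\<^sub>1 c\<^sub>2\<close> of \<open>y\<close> is neither of them.\<close>

lemma commute_if_card_8:
  assumes W8: "card W = 8"
  shows "c \<otimes> c\<^sub>1 = c\<^sub>1 \<otimes> c"
proof (rule ccontr)
  assume nc: "c \<otimes> c\<^sub>1 \<noteq> c\<^sub>1 \<otimes> c"
  define y where "y = c \<otimes> c\<^sub>1"
  have yC: "y \<in> carrier G" by (simp add: y_def)
  have yW: "y \<in> W" unfolding y_def using W_mem subgroup.m_closed[OF subgroup_W] by blast
  have fW: "finite W" by (rule finite_subgroup[OF fin subgroup_W])
  \<comment> \<open>An involution is its own inverse, so inverting the product of two of them
    reverses it.\<close>
  have sq: "u \<otimes> v = v \<otimes> u"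
    if "u \<in> carrier G" "v \<in> carrier G" "u \<otimes> u = \<one>" "v \<otimes> v = \<one>" "(u \<otimes> v) \<otimes> (u \<otimes> v) = \<one>" for u v
  proof -
    have "inv (u \<otimes> v) = u \<otimes> v" using that by (intro inv_equality) auto
    moreover have "inv u = u" "inv v = v" using that by (auto intro: inv_equality)
    ultimately show ?thesis using that by (simp add: inv_mult_group)
  qed
  have y2: "y \<otimes> y \<noteq> \<one>" using sq[of c c\<^sub>1] nc c2 c1_c2_sq by (auto simp: y_def)
  define Y where "Y = generate G {y}"
  have Ys: "subgroup Y G" unfolding Y_def by (rule generate_is_subgroup) (simp add: yC)
  have YW: "Y \<subseteq> W" unfolding Y_def by (rule generate_subgroup_incl[OF _ subgroup_W]) (simp add: yW)
  have Ypow: "\<exists>k::nat. u = y [^] k" if "u \<in> Y" for u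
    using that generate_pow_on_finite_carrier[OF fin yC] unfolding Y_def by blast
  have Ycomm: "u \<otimes> v = v \<otimes> u" if "u \<in> Y" "v \<in> Y" for u v
    using Ypow[OF that(1)] Ypow[OF that(2)] yC by (auto simp: nat_pow_mult add.commute)
  have cY: "c \<notin> Y"
  proof
    assume "c \<in> Y"
    then have "c \<otimes> y = y \<otimes> c" using Ycomm generate.incl[of y "{y}" G] unfolding Y_def by blast
    then have "c\<^sub>1 = c \<otimes> (c\<^sub>1 \<otimes> c)" by (simp add: y_def m_assoc rels)
    then have "c \<otimes> c\<^sub>1 = c \<otimes> (c \<otimes> (c\<^sub>1 \<otimes> c))" by simp
    then show False using nc by (simp add: rels)
  qed
  \<comment> \<open>\<open>c\<close> inverts \<open>y\<close>, so everything in the coset of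
    \<open>Y\<close> through \<open>c\<close> squares to 1, as for the reflections of a dihedral
    group.\<close>
  have cu: "(c \<otimes> y [^] k) \<otimes> (c \<otimes> y [^] k) = \<one>" for k :: nat
  proof (induction k)
    case 0
    then show ?case by (simp add: c2)
  next
    case (Suc k)
    have e: "y \<otimes> (c \<otimes> (y \<otimes> z)) = c \<otimes> z" if "z \<in> carrier G" for z
      using that by (simp add: y_def m_assoc rels c_sq_cancel)
    have "(c \<otimes> y [^] Suc k) \<otimes> (c \<otimes> y [^] Suc k)
        = c \<otimes> (y [^] k \<otimes> (y \<otimes> (c \<otimes> (y \<otimes> y [^] k))))"
    proof -
      have "(c \<otimes> y [^] Suc k) \<otimes> (c \<otimes> y [^] Suc k) = (c \<otimes> (y [^] k \<otimes> y)) \<otimes> (c \<otimes> (y \<otimes> y [^] k))"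
        by (metis nat_pow_Suc nat_pow_Suc2[OF yC])
      then show ?thesis using yC by (simp only: m_assoc m_closed nat_pow_closed cc)
    qed
    also have "\<dots> = (c \<otimes> y [^] k) \<otimes> (c \<otimes> y [^] k)"
      using yC by (simp add: e m_assoc)
    finally have "(c \<otimes> y [^] Suc k) \<otimes> (c \<otimes> y [^] Suc k) = (c \<otimes> y [^] k) \<otimes> (c \<otimes> y [^] k)" .
    then show ?case using Suc by simp
  qed
  define Z where "Z = (\<lambda>u. c \<otimes> u) ` Y"
  have ZC: "card Z = card Y" unfolding Z_def
    by (rule card_image, rule inj_onI) (use subgroup.mem_carrier[OF Ys] in simp)
  have YZ: "Y \<inter> Z = {}"
  proof (rule ccontr)
    assume "Y \<inter> Z \<noteq> {}"
    then obtain u where u: "u \<in> Y" "c \<otimes> u \<in> Y" unfolding Z_def by blast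
    then have "c \<otimes> u \<otimes> inv u \<in> Y" using subgroup.m_closed[OF Ys] subgroup.m_inv_closed[OF Ys] by blast
    then show False using cY u subgroup.mem_carrier[OF Ys] by (simp add: m_assoc)
  qed
  have ZW: "Z \<subseteq> W" unfolding Z_def using YW W_mem subgroup.m_closed[OF subgroup_W] by blast
  have cYZ: "card (Y \<union> Z) = 2 * card Y"
    using card_Un_disjoint[OF finite_subset[OF YW fW] finite_subset[OF ZW fW] YZ] ZC by simp
  have cle: "2 * card Y \<le> 8" using card_mono[OF fW, of "Y \<union> Z"] YW ZW cYZ W8 by simp
  have ordY: "card Y = ord y" unfolding Y_def using generate_pow_card[OF yC] by simp
  have "card Y dvd 8" using card_dvd_subgroup[OF fin subgroup_W Ys YW] W8 by simp
  moreover have "\<not> ord y dvd 2" using pow_eq_id[OF yC, of 2] y2 yC by (simp add: numeral_2_eq_2)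
  \<comment> \<open>\<open>Y\<close> and its translate by \<open>c\<close> are disjoint in
    \<open>W\<close>, so |Y| <= 4; being a divisor of 8 that does not divide 2, it is 4.\<close>
  ultimately have o4: "ord y = 4"
  proof -
    assume "card Y dvd 8" "\<not> ord y dvd 2"
    moreover have "ord y = 1 \<or> ord y = 2 \<or> ord y = 3 \<or> ord y = 4"
      using cle ordY \<open>card Y dvd 8\<close> by (cases "card Y = 0") auto
    ultimately show ?thesis using ordY by auto
  qed
  have WYZ: "Y \<union> Z = W" using cYZ ordY o4 W8 YW ZW fW by (simp add: card_subset_eq)
  define y' where "y' = c\<^sub>1 \<otimes> c\<^sub>2"
  have y'2: "y' \<otimes> y' \<noteq> \<one>"
    using sq[of c\<^sub>1 c\<^sub>2] commute_rotate nc c1_c2_sq by (auto simp: y'_def)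
  have y'W: "y' \<in> W" unfolding y'_def using W_mem subgroup.m_closed[OF subgroup_W] by blast
  have "y' \<notin> Z"
  proof
    assume "y' \<in> Z"
    then obtain u where u: "u \<in> Y" "y' = c \<otimes> u" unfolding Z_def by blast
    then obtain k :: nat where "u = y [^] k" using Ypow by blast
    then show False using y'2 cu u by simp
  qed
  then have "y' \<in> Y" using y'W WYZ by blast
  then obtain k :: nat where k: "y' = y [^] k" using Ypow by blast
  have y4: "y [^] (4::nat) = \<one>" using pow_eq_id[OF yC, of 4] o4 by simp
  have "y' = (y [^] (4::nat)) [^] (k div 4) \<otimes> y [^] (k mod 4)"
    using k yC by (simp only: nat_pow_pow nat_pow_mult) simp
  then have k4: "y' = y [^] (k mod 4)" using y4 yC by simp
  have e3: "y [^] (3::nat) = inv y"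
    using y4 yC by (intro inv_equality[symmetric]) (simp_all add: numeral_eq_Suc m_assoc)
  have "k mod 4 = 0 \<or> k mod 4 = 1 \<or> k mod 4 = 2 \<or> k mod 4 = 3" by linarith
  then consider "y' = \<one>" | "y' = y" | "y' = y [^] (2::nat)" | "y' = inv y"
    using k4 e3 yC by auto
  then show False
  proof cases
    case 1
    then show False using y'2 by simp
  next
    case 2
    then have e: "c\<^sub>1 \<otimes> c\<^sub>2 = c \<otimes> c\<^sub>1" by (simp add: y_def y'_def)
    have e': "c\<^sub>2 \<otimes> c = c\<^sub>1 \<otimes> c\<^sub>2"
      using arg_cong[OF e, of "\<lambda>u. x \<otimes> u \<otimes> inv x"] by (simp add: conj_x_mult conj_x)
    \<comment> \<open>All three cyclic products equal \<open>y\<close>, and multiplying them in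
      order telescopes to 1. With the fourth power of \<open>y\<close> also trivial,
      \<open>y\<close> itself is.\<close>
    have "y \<otimes> y \<otimes> y = (c \<otimes> c\<^sub>1) \<otimes> (c\<^sub>1 \<otimes> c\<^sub>2) \<otimes> (c\<^sub>2 \<otimes> c)"
      unfolding y_def using e e' by simp
    also have "\<dots> = \<one>" by (simp add: m_assoc c_sq_cancel c2)
    finally have "y \<otimes> y \<otimes> y = \<one>" .
    moreover have "y [^] (4::nat) = y \<otimes> y \<otimes> y \<otimes> y" using yC by (simp add: numeral_eq_Suc)
    ultimately have "y = \<one>" using y4 yC by simp
    then show False using y2 by simp
  next
    case 3
    then have "y' \<otimes> y' = y [^] (4::nat)" using yC by (simp add: nat_pow_mult)
    then show False using y4 y'2 by simp
  next
    case 4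
    then have "c\<^sub>1 \<otimes> c\<^sub>2 = c\<^sub>1 \<otimes> c" by (simp add: y_def y'_def inv_mult_group inv_c invs)
    then have e: "c\<^sub>2 = c" by simp
    then have "c = c\<^sub>1" using conj_x by metis
    then show False using nc by simp
  qed
qed

text \<open>Modulo \<open>K\<close> the group \<open>W\<close> is a Klein four-group with involutions \<open>c\<close>, \<open>c\<^sub>1\<close>, \<open>c\<^sub>2\<close>, so \<open>c c\<^sub>1 c\<^sub>2\<close> lies in \<open>K\<close>.
  Its square is both centralized and inverted by \<open>c\<close>, hence \<open>c c\<^sub>1 c\<^sub>2 = 1\<close> and \<open>W\<close> has order 4.\<close>

lemma no_normal_order_3_if_card_12:
  assumes W12: "card W = 12" and K: "K \<lhd> G" "card K = 3" "K \<subseteq> W"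
  shows False
proof -
  have Ks: "subgroup K G" by (rule normal_imp_subgroup[OF K(1)])
  note KC = subgroup.mem_carrier[OF Ks]
  have fW: "finite W" by (rule finite_subgroup[OF fin subgroup_W])
  have Kx: "x \<otimes> u \<otimes> inv x \<in> K" if "u \<in> K" for u by (rule normal.inv_op_closed2[OF K(1) cx that])
  have small: False if H: "subgroup H G" "c \<in> H" "c\<^sub>1 \<in> H" "c\<^sub>2 \<in> H" "card H < 12" for H
  proof -
    have "W \<subseteq> H" unfolding W_def by (rule generate_subgroup_incl[OF _ H(1)]) (use H in blast)
    then have "12 \<le> card H" using card_mono[OF finite_subgroup[OF fin H(1)]] W12 by metis
    then show False using H by simp
  qed
  have cK: "c \<notin> K"
  proof
    assume c: "c \<in> K"
    then have "c\<^sub>1 \<in> K" using Kx conj_x by metis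
    then have "c\<^sub>2 \<in> K" using Kx conj_x by metis
    then show False using small[OF Ks] c \<open>c\<^sub>1 \<in> K\<close> K(2) by simp
  qed
  have rot: "c\<^sub>1 \<in> K \<Longrightarrow> c\<^sub>2 \<in> K" "c\<^sub>2 \<in> K \<Longrightarrow> c \<in> K" using Kx conj_x by metis+
  have cK': "c\<^sub>1 \<notin> K" "c\<^sub>2 \<notin> K" using rot cK by blast+
  \<comment> \<open>Otherwise all three conjugates lie in the subgroup generated by \<open>c\<close>
    and \<open>K\<close>, of order at most 6.\<close>
  have c01: "c \<otimes> c\<^sub>1 \<notin> K"
  proof
    assume a: "c \<otimes> c\<^sub>1 \<in> K"
    have b: "c\<^sub>1 \<otimes> c\<^sub>2 \<in> K" using Kx[OF a] by (simp add: conj_x_mult conj_x)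
    define H where "H = generate G (insert c K)"
    have H: "subgroup H G" unfolding H_def
      by (rule generate_is_subgroup) (use KC in auto)
    have cH: "c \<in> H" and KH: "K \<subseteq> H" unfolding H_def by (auto intro: generate.incl)
    have "c \<otimes> (c \<otimes> c\<^sub>1) \<in> H" using cH a KH subgroup.m_closed[OF H] by blast
    then have c1H: "c\<^sub>1 \<in> H" by (simp add: rels)
    have "c\<^sub>1 \<otimes> (c\<^sub>1 \<otimes> c\<^sub>2) \<in> H" using c1H b KH subgroup.m_closed[OF H] by blast
    then have c2H: "c\<^sub>2 \<in> H" by (simp add: c_sq_cancel)
    have "card H \<le> 2 * card K" unfolding H_def
      by (rule card_insert_normal_le[OF fin K(1) cc]) (simp_all add: numeral_2_eq_2 c2)
    then show False using small[OF H cH c1H c2H] K(2) by simp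
  qed
  have c12: "c\<^sub>1 \<otimes> c\<^sub>2 \<notin> K" and c20: "c\<^sub>2 \<otimes> c \<notin> K"
  proof -
    show "c\<^sub>2 \<otimes> c \<notin> K" using Kx[of "c\<^sub>2 \<otimes> c"] c01 by (auto simp: conj_x_mult conj_x)
    then show "c\<^sub>1 \<otimes> c\<^sub>2 \<notin> K" using Kx[of "c\<^sub>1 \<otimes> c\<^sub>2"] by (auto simp: conj_x_mult conj_x)
  qed
  have coset: "K #> u = K #> v \<Longrightarrow> u \<otimes> inv v \<in> K" if "u \<in> carrier G" "v \<in> carrier G" for u v
    using that subgroup.rcos_module[OF Ks is_group] rcos_self[OF _ Ks]
    by (metis)
  \<comment> \<open>These four cosets turn out to be distinct, so they exhaust the quotient of
    \<open>W\<close> by \<open>K\<close>. The coset of \<open>c c\<^sub>1\<close> is then identified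
    by elimination as that of \<open>c\<^sub>2\<close>.\<close>
  define A where "A = {K #> \<one>, K #> c, K #> c\<^sub>1, K #> c\<^sub>2}"
  have c02: "c \<otimes> c\<^sub>2 \<notin> K"
  proof
    assume "c \<otimes> c\<^sub>2 \<in> K"
    then have "inv (c \<otimes> c\<^sub>2) \<in> K" by (rule subgroup.m_inv_closed[OF Ks])
    then show False using c20 by (simp add: inv_mult_group invs inv_c)
  qed
  have "card A = 4"
  proof -
    have "K #> \<one> \<noteq> K #> c" "K #> \<one> \<noteq> K #> c\<^sub>1" "K #> \<one> \<noteq> K #> c\<^sub>2"
      using coset[of \<one> c] coset[of \<one> c\<^sub>1] coset[of \<one> c\<^sub>2] cK cK' by (auto simp: invs inv_c)
    moreover have "K #> c \<noteq> K #> c\<^sub>1" "K #> c \<noteq> K #> c\<^sub>2" "K #> c\<^sub>1 \<noteq> K #> c\<^sub>2"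
      using coset[of c c\<^sub>1] coset[of c c\<^sub>2] coset[of c\<^sub>1 c\<^sub>2] c01 c02 c12 by (auto simp: invs inv_c)
    ultimately show ?thesis unfolding A_def by simp
  qed
  define B where "B = (\<lambda>u. K #> u) ` W"
  have "card B = 4"
  proof -
    let ?W = "G\<lparr>carrier := W\<rparr>"
    have "B = rcosets\<^bsub>?W\<^esub> K" unfolding B_def RCOSETS_def by auto
    moreover have "card (rcosets\<^bsub>?W\<^esub> K) = 4"
      by (rule group.card_rcosets_eq[OF subgroup_as_group(1)[OF subgroup_W] _
          subgroup_as_group(2)[OF subgroup_W Ks K(3)]]) (use fW W12 K in auto)
    ultimately show ?thesis by simp
  qed
  moreover have "A \<subseteq> B" unfolding A_def B_def using W_mem subgroup.one_closed[OF subgroup_W] by blast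
  moreover have "finite B" unfolding B_def using fW by simp
  ultimately have "A = B" using \<open>card A = 4\<close> by (simp add: card_subset_eq)
  moreover have "c \<otimes> c\<^sub>1 \<in> W" using W_mem subgroup.m_closed[OF subgroup_W] by blast
  ultimately have "K #> (c \<otimes> c\<^sub>1) \<in> A" unfolding B_def by blast
  moreover have "K #> (c \<otimes> c\<^sub>1) \<noteq> K #> \<one>" using coset[of "c \<otimes> c\<^sub>1" \<one>] c01 by auto
  moreover have "K #> (c \<otimes> c\<^sub>1) \<noteq> K #> c\<^sub>1"
    using coset[of "c \<otimes> c\<^sub>1" "c\<^sub>1"] cK by (auto simp: inv_c m_assoc c1_c2_sq)
  moreover have "K #> (c \<otimes> c\<^sub>1) \<noteq> K #> c"
  proof
    assume "K #> (c \<otimes> c\<^sub>1) = K #> c"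
    from coset[OF _ _ this] have "c \<otimes> c\<^sub>1 \<otimes> c \<in> K" by (simp add: invs)
    from normal.inv_op_closed2[OF K(1) cc this] show False using cK' by (simp add: m_assoc invs rels c2)
  qed
  ultimately have "K #> (c \<otimes> c\<^sub>1) = K #> c\<^sub>2" unfolding A_def by blast
  from coset[OF _ _ this] have kK: "c \<otimes> c\<^sub>1 \<otimes> c\<^sub>2 \<in> K" by (simp add: inv_c)
  define k where "k = c \<otimes> (c\<^sub>1 \<otimes> c\<^sub>2)"
  have kK: "k \<in> K" using kK by (simp add: k_def m_assoc)
  have kC: "k \<in> carrier G" by (simp add: k_def)
  \<comment> \<open>Conjugation by \<open>x\<close> rotates the three factors of \<open>k\<close>
    and also fixes \<open>k\<close>. Hence all cyclic rotations of the product agree, which makes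
    \<open>k\<close> commute with \<open>c\<close> and \<open>c\<^sub>2\<close>.\<close>
  have xk: "x \<otimes> k \<otimes> inv x = k" by (rule order_3_centralizes_normal_order_3[OF fin K(1,2) cx x3 kK])
  have k1: "k = c\<^sub>1 \<otimes> (c\<^sub>2 \<otimes> c)"
    using xk by (simp add: k_def conj_x_mult conj_x)
  have k2: "k = c\<^sub>2 \<otimes> (c \<otimes> c\<^sub>1)"
    using xk by (simp add: k1 conj_x_mult conj_x)
  have ck: "c \<otimes> k = k \<otimes> c"
  proof -
    have "c \<otimes> k = c\<^sub>1 \<otimes> c\<^sub>2" by (simp add: k_def rels)
    moreover have "k \<otimes> c = c\<^sub>1 \<otimes> c\<^sub>2" by (simp add: k1 m_assoc c2)
    ultimately show ?thesis by simp
  qed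
  have c2k: "c\<^sub>2 \<otimes> k = k \<otimes> c\<^sub>2"
  proof -
    have "c\<^sub>2 \<otimes> k = c \<otimes> c\<^sub>1" by (simp add: k2 c_sq_cancel)
    moreover have "k \<otimes> c\<^sub>2 = c \<otimes> c\<^sub>1" by (simp add: k_def m_assoc c1_c2_sq)
    ultimately show ?thesis by simp
  qed
  have p: "c \<otimes> c\<^sub>1 = k \<otimes> c\<^sub>2" by (simp add: k_def m_assoc c1_c2_sq)
  have kk: "k \<otimes> k = (c \<otimes> c\<^sub>1) \<otimes> (c \<otimes> c\<^sub>1)"
  proof -
    have "(k \<otimes> c\<^sub>2) \<otimes> (k \<otimes> c\<^sub>2) = k \<otimes> (c\<^sub>2 \<otimes> k) \<otimes> c\<^sub>2" using kC by (simp add: m_assoc)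
    also have "\<dots> = k \<otimes> k" unfolding c2k using kC by (simp add: m_assoc c1_c2_sq)
    finally show ?thesis using p by simp
  qed
  have "c \<otimes> (k \<otimes> k) \<otimes> c = k \<otimes> k"
  proof -
    have "c \<otimes> (k \<otimes> k) \<otimes> c = (c \<otimes> k) \<otimes> k \<otimes> c" using kC by (simp add: m_assoc)
    also have "\<dots> = (k \<otimes> c) \<otimes> k \<otimes> c" by (simp only: ck)
    also have "\<dots> = k \<otimes> (c \<otimes> k) \<otimes> c" using kC by (simp add: m_assoc)
    also have "\<dots> = k \<otimes> (k \<otimes> c) \<otimes> c" by (simp only: ck)
    also have "\<dots> = k \<otimes> k" using kC by (simp add: m_assoc c2)
    finally show ?thesis .
  qed
  \<comment> \<open>\<open>k\<close> squared equals the square of \<open>c c\<^sub>1\<close>, and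
    \<open>c\<close> inverts \<open>c c\<^sub>1\<close>. Together with the preceding equation the
    fourth power of \<open>k\<close> is 1; as its cube is 1 too, \<open>k\<close> is
    trivial.\<close>
  moreover have "c \<otimes> (k \<otimes> k) \<otimes> c = inv (k \<otimes> k)"
    unfolding kk by (simp add: inv_mult_group invs inv_c m_assoc rels)
  ultimately have "inv (k \<otimes> k) = k \<otimes> k" by simp
  then have "(k \<otimes> k) \<otimes> (k \<otimes> k) = \<one>" using kC r_inv[of "k \<otimes> k"] by simp
  moreover have "k \<otimes> (k \<otimes> k) = \<one>"
    using pow_card_subgroup[OF fin Ks kK] K(2) kC by (simp add: numeral_3_eq_3 m_assoc)
  ultimately have k0: "k = \<one>" using kC by (simp add: m_assoc)
  have e: "c \<otimes> c\<^sub>1 = c\<^sub>2" using p k0 by simp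
  have cm: "c\<^sub>1 \<otimes> c = c\<^sub>2"
  proof -
    have "inv (c \<otimes> c\<^sub>1) = c\<^sub>1 \<otimes> c" by (simp add: inv_mult_group invs inv_c)
    then show ?thesis unfolding e by (simp add: inv_c)
  qed
  define H where "H = {\<one>, c, c\<^sub>1, c \<otimes> c\<^sub>1}"
  have "subgroup H G" unfolding H_def
    by (rule subgroup_klein) (simp_all add: c2 c1_c2_sq e cm)
  moreover have "card H \<le> 4" unfolding H_def using card_length[of "[\<one>, c, c\<^sub>1, c \<otimes> c\<^sub>1]"] by simp
  ultimately show False using small[of H] e by (simp add: H_def)
qed

text \<open>If |N| = 9, then \<open>x\<close> lies in \<open>N\<close>, the index 8 being prime to
  3, and adjoining \<open>a\<close> and \<open>c\<close> reaches at most 36 elements. If |N| = 3, a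
  Sylow 2-subgroup times \<open>N\<close> has index 3. Its core has order 12, contains
  \<open>N\<close>, and equals the subgroup generated by the conjugates of \<open>c\<close> or of
  \<open>a c\<close>, which is impossible.\<close>

theorem card_ne_72: "card (carrier G) \<noteq> 72"
proof
  assume c72: "card (carrier G) = 72"
  obtain N where N: "N \<lhd> G" "card N = 9 \<or> card N = 3"
    using order_72_normal_3_subgroup[OF fin c72] .
  have Ns: "subgroup N G" by (rule normal_imp_subgroup[OF N(1)])
  from N(2) show False
  proof
    assume N9: "card N = 9"
    have xN: "x \<in> N"
      by (rule coprime_index_mem[OF fin N(1) cx, of 3 8])
        (simp_all add: x_pow_3 c72 N9 coprime_3_8)
    have s: "{a, x, c} \<subseteq> insert c (insert a N)" using xN by blast
    have sub: "insert a N \<subseteq> carrier G" using subgroup.subset[OF Ns] by simp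
    have "carrier G \<subseteq> generate G (insert c (insert a N))" using mono_generate[OF s] gen by simp
    then have "72 \<le> card (generate G (insert c (insert a N)))"
      unfolding c72[symmetric]
      by (rule card_mono[rotated]) (rule finite_subset[OF generate_incl fin], use sub in auto)
    also have "\<dots> \<le> 2 * card (generate G (insert a N))"
    proof (rule card_generate_insert_le[OF fin sub cc])
      fix h assume h: "h \<in> insert a N"
      show "c \<otimes> h \<otimes> inv c \<in> generate G (insert a N)"
      proof (cases "h = a")
        case True
        have "c \<otimes> a \<otimes> inv c = a" by (simp add: word_simps)
        then show ?thesis using True by (simp add: generate.incl)
      next
        case False
        then show ?thesis using h normal.inv_op_closed2[OF N(1) cc] by (auto intro: generate.incl)
      qed
    qed (simp_all add: numeral_2_eq_2 c2)
    also have "card (generate G (insert a N)) \<le> 2 * card N"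
      by (rule card_insert_normal_le[OF fin N(1) ca]) (simp_all add: numeral_2_eq_2 aa)
    finally show False using N9 by simp
  next
    assume N3: "card N = 3"
    have "order G = 2 ^ 3 * 9" using c72 by (simp add: order_def)
    then obtain Q where Q: "subgroup Q G" "card Q = 8"
      using sylow_thm[of 2 G 3 9] fin is_group by auto
    have QN: "Q \<inter> N = {\<one>}"
      by (rule coprime_card_Int_trivial[OF fin Q(1) Ns]) (simp add: Q N3 coprime_3_8 coprime_commute)
    define M where "M = Q <#> N"
    have M: "subgroup M G" "card M = 24" unfolding M_def
      using set_mult_disjoint_normal[OF fin N(1) Q(1) QN] Q N3 by auto
    have NM: "N \<subseteq> M"
    proof
      fix n assume "n \<in> N"
      then have "\<one> \<otimes> n \<in> M" unfolding M_def set_mult_def using subgroup.one_closed[OF Q(1)] by blast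
      then show "n \<in> M" using subgroup.mem_carrier[OF Ns \<open>n \<in> N\<close>] by simp
    qed
    obtain L where L: "L \<lhd> G" "card (carrier G) = 6 * card L" "c \<in> L \<or> a \<otimes> c \<in> L"
      and max: "\<And>K. K \<lhd> G \<Longrightarrow> K \<subseteq> M \<Longrightarrow> K \<subseteq> L"
      by (rule index_six_core[OF M(1)]) (simp add: M c72, blast)
    have NL: "N \<subseteq> L" by (rule max[OF N(1) NM])
    from L(3) show False
    proof
      assume "c \<in> L"
      then have "W = L" using W_eq_normal L by blast
      then show False using no_normal_order_3_if_card_12[OF _ N(1) N3] NL L(2) c72 by simp
    next
      assume ac: "a \<otimes> c \<in> L"
      interpret A: D3_D2_amalgam G a x "a \<otimes> c" by (rule D3_D2_amalgam_ac)
      have "A.W = L" using A.W_eq_normal L ac by blast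
      then show False using A.no_normal_order_3_if_card_12[OF _ N(1) N3] NL L(2) c72 by simp
    qed
  qed
qed

text \<open>Conjugating by \<open>x\<close> spreads the commutation to all pairs of conjugates, so
  \<open>W\<close> is generated by three commuting elements of square 1 and has order at most 8; 48
  is 6 times 8.\<close>

lemma card_le_48_if_commute:
  assumes cm: "c \<otimes> c\<^sub>1 = c\<^sub>1 \<otimes> c"
  shows "card (carrier G) \<le> 48"
proof -
  have cm1: "c\<^sub>1 \<otimes> c\<^sub>2 = c\<^sub>2 \<otimes> c\<^sub>1"
    using arg_cong[OF cm, of "\<lambda>u. x \<otimes> u \<otimes> inv x"] by (simp add: conj_x_mult conj_x)
  have cm2: "c\<^sub>2 \<otimes> c = c \<otimes> c\<^sub>2"
    using arg_cong[OF cm1, of "\<lambda>u. x \<otimes> u \<otimes> inv x"] by (simp add: conj_x_mult conj_x)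
  have cjid: "u \<otimes> v \<otimes> inv u = v" if "u \<otimes> v = v \<otimes> u" "u \<in> carrier G" "v \<in> carrier G" for u v
    using that by (simp add: m_assoc)
  have pow: "u [^] (2::nat) = \<one>" if "u \<otimes> u = \<one>" "u \<in> carrier G" for u
    using that by (simp add: numeral_2_eq_2)
  have k: "\<And>u. u \<in> A \<Longrightarrow> u \<in> generate G A" for A by (rule generate.incl)
  have "card (generate G {c}) \<le> 2 * card (generate G {})"
    by (rule card_generate_insert_le[OF fin]) (simp_all add: pow c2)
  also have "generate G {} = {\<one>}" by (rule generate_empty)
  finally have 1: "card (generate G {c}) \<le> 2" by simp
  have 2: "card (generate G {c\<^sub>1, c}) \<le> 2 * card (generate G {c})"
    by (rule card_generate_insert_le[OF fin]) (simp_all add: pow c1_c2_sq cjid cm k)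
  have 3: "card (generate G {c\<^sub>2, c\<^sub>1, c}) \<le> 2 * card (generate G {c\<^sub>1, c})"
    by (rule card_generate_insert_le[OF fin]) (auto simp: pow c1_c2_sq cjid[OF cm1[symmetric]] cjid[OF cm2] k)
  have "{c\<^sub>2, c\<^sub>1, c} = {c, c\<^sub>1, c\<^sub>2}" by blast
  then show ?thesis using card_le_W 1 2 3 unfolding W_def by simp
qed

end

section \<open>Recognizing the symmetric group of degree 4 times Z/2\<close>

lemma iso_of_surj_hom:
  assumes G: "group G" and H: "group H" and h: "h \<in> hom G H" "h ` carrier G = carrier H"
    and c: "finite (carrier G)" "card (carrier G) \<le> card (carrier H)"
  shows "h \<in> iso G H"
proof -
  have "inj_on h (carrier G)"
    using c h(2) card_image_le[OF c(1), of h] by (intro eq_card_imp_inj_on) auto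
  then show ?thesis using h by (simp add: iso_def bij_betw_def)
qed

text \<open>Goursat-style: the subgroup of \<open>G \<times> H\<close> generated by the pairs of corresponding generators satisfies
  the same relations, so it has order at most 48 and both projections are isomorphisms.\<close>

lemma D3_D2_amalgam_iso:
  assumes G: "D3_D2_amalgam G a x c" and H: "D3_D2_amalgam H a' x' c'"
    and cG: "c \<otimes>\<^bsub>G\<^esub> (x \<otimes>\<^bsub>G\<^esub> c \<otimes>\<^bsub>G\<^esub> inv\<^bsub>G\<^esub> x) = (x \<otimes>\<^bsub>G\<^esub> c \<otimes>\<^bsub>G\<^esub> inv\<^bsub>G\<^esub> x) \<otimes>\<^bsub>G\<^esub> c"
    and cH: "c' \<otimes>\<^bsub>H\<^esub> (x' \<otimes>\<^bsub>H\<^esub> c' \<otimes>\<^bsub>H\<^esub> inv\<^bsub>H\<^esub> x') = (x' \<otimes>\<^bsub>H\<^esub> c' \<otimes>\<^bsub>H\<^esub> inv\<^bsub>H\<^esub> x') \<otimes>\<^bsub>H\<^esub> c'"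
    and card: "card (carrier G) = 48" "card (carrier H) = 48"
  shows "G \<cong> H"
proof -
  interpret G: D3_D2_amalgam G a x c by fact
  interpret H: D3_D2_amalgam H a' x' c' by fact
  interpret P: group "G \<times>\<times> H" by (rule DirProd_group[OF G.is_group H.is_group])
  define S where "S = {(a, a'), (x, x'), (c, c')}"
  have SC: "S \<subseteq> carrier (G \<times>\<times> H)" by (simp add: S_def)
  define D where "D = generate (G \<times>\<times> H) S"
  have Ds: "subgroup D (G \<times>\<times> H)" unfolding D_def by (rule P.generate_is_subgroup[OF SC])
  let ?D = "(G \<times>\<times> H)\<lparr>carrier := D\<rparr>"
  have SD: "S \<subseteq> D" unfolding D_def by (auto intro: generate.incl)
  have fD: "finite D"
    using P.finite_subgroup[OF _ Ds] G.fin H.fin by (simp add: DirProd_def)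
  interpret D: group ?D by (rule P.subgroup_imp_group[OF Ds])
  interpret D: D3_D2_amalgam ?D "(a, a')" "(x, x')" "(c, c')"
  proof
    show "finite (carrier ?D)" using fD by simp
    show "(a, a') \<in> carrier ?D" "(x, x') \<in> carrier ?D" "(c, c') \<in> carrier ?D"
      using SD by (auto simp: S_def)
    show "generate ?D {(a, a'), (x, x'), (c, c')} = carrier ?D"
      using P.generate_consistent[OF SD Ds] by (simp add: S_def D_def)
  qed (simp_all add: G.aa G.c2 G.x3 G.ac G.ax H.aa H.c2 H.x3 H.ac H.ax)
  have "inv\<^bsub>?D\<^esub> (x, x') = (inv\<^bsub>G\<^esub> x, inv\<^bsub>H\<^esub> x')"
    by (simp add: D.invs G.invs H.invs)
  then have D48: "card D \<le> 48"
    using D.card_le_48_if_commute cG cH unfolding D.c\<^sub>1_def by simp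
  have f: "group_hom (G \<times>\<times> H) G fst" "group_hom (G \<times>\<times> H) H snd"
    by (unfold_locales; auto simp: hom_def DirProd_def)+
  have hom: "fst \<in> hom ?D G" "snd \<in> hom ?D H"
    using subgroup.subset[OF Ds] by (auto simp: hom_def DirProd_def)
  have "fst ` D = carrier G"
    using group_hom.generate_img[OF f(1) SC] G.gen unfolding D_def S_def by simp
  then have "fst \<in> iso ?D G"
    using fD D48 card by (intro iso_of_surj_hom[OF D.is_group G.is_group hom(1)]) auto
  then have "?D \<cong> G" unfolding is_iso_def by blast
  moreover have "snd ` D = carrier H"
    using group_hom.generate_img[OF f(2) SC] H.gen unfolding D_def S_def by simp
  then have "snd \<in> iso ?D H"
    using fD D48 card by (intro iso_of_surj_hom[OF D.is_group H.is_group hom(2)]) auto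
  then have "?D \<cong> H" unfolding is_iso_def by blast
  ultimately show ?thesis using D.iso_sym iso_trans by blast
qed

abbreviation (input) "S4_Z2 \<equiv> sym_group 4 \<times>\<times> integer_mod_group 2"

lemma group_S4_Z2: "group S4_Z2"
  by (rule DirProd_group[OF sym_group_is_group group_integer_mod_group])

lemma finite_S4_Z2: "finite (carrier S4_Z2)" and card_S4_Z2: "card (carrier S4_Z2) = 48"
proof -
  have "card (carrier (sym_group 4)) = 24" by (simp add: sym_group_card_carrier fact_numeral)
  then show "card (carrier S4_Z2) = 48"
    by (simp add: card_cartesian_product carrier_integer_mod_group)
  then show "finite (carrier S4_Z2)" using card.infinite by fastforce
qed

lemma mem_S4_Z2: "(p, e) \<in> carrier S4_Z2 \<longleftrightarrow> p permutes {1..4} \<and> (e = 0 \<or> e = 1)"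
  by (auto simp: sym_group_carrier carrier_integer_mod_group)

lemma mult_S4_Z2: "(p, e) \<otimes>\<^bsub>S4_Z2\<^esub> (q, f) = (p \<circ> q, (e + f) mod 2)"
  by (simp add: sym_group_mult)

lemma one_S4_Z2: "\<one>\<^bsub>S4_Z2\<^esub> = (id, 0)"
  by (simp add: sym_group_one)

abbreviation (input) "tau i j \<equiv> Transposition.transpose (i::nat) j"

lemma fun_eq_4:
  fixes f g :: "nat \<Rightarrow> nat"
  assumes "f 1 = g 1" "f 2 = g 2" "f 3 = g 3" "f 4 = g 4"
    and "\<And>z. z \<noteq> 1 \<Longrightarrow> z \<noteq> 2 \<Longrightarrow> z \<noteq> 3 \<Longrightarrow> z \<noteq> 4 \<Longrightarrow> f z = g z"
  shows "f = g"
  using assms by (metis ext)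

lemma Pair_eqI: "p = q \<Longrightarrow> e = f \<Longrightarrow> (p, e) = (q, f)"
  by simp

text \<open>\<open>a\<close> is a transposition, \<open>x\<close> a 3-cycle on 1, 2, 3, and
  \<open>c\<close> a double transposition carrying the generator of Z/2. The three double
  transpositions commute and multiply to the identity, but their Z/2-components add up to 1; so the
  conjugates of \<open>c\<close> generate a group of order 8, and the central factor is
  reached.\<close>

lemma S4_Z2_amalgam:
  defines "a \<equiv> (tau 1 2, 0::int)" and "x \<equiv> (tau 1 2 \<circ> tau 2 3, 0::int)" and "c \<equiv> (tau 1 2 \<circ> tau 3 4, 1::int)"
  shows "D3_D2_amalgam S4_Z2 a x c"
    and "c \<otimes>\<^bsub>S4_Z2\<^esub> (x \<otimes>\<^bsub>S4_Z2\<^esub> c \<otimes>\<^bsub>S4_Z2\<^esub> inv\<^bsub>S4_Z2\<^esub> x) = (x \<otimes>\<^bsub>S4_Z2\<^esub> c \<otimes>\<^bsub>S4_Z2\<^esub> inv\<^bsub>S4_Z2\<^esub> x) \<otimes>\<^bsub>S4_Z2\<^esub> c"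
proof -
  interpret group S4_Z2 by (rule group_S4_Z2)
  have C: "a \<in> carrier S4_Z2" "x \<in> carrier S4_Z2" "c \<in> carrier S4_Z2"
    unfolding a_def x_def c_def mem_S4_Z2 by (simp_all add: permutes_compose permutes_swap_id)
  define L where "L = generate S4_Z2 {a, x, c}"
  have Ls: "subgroup L S4_Z2" unfolding L_def by (rule generate_is_subgroup) (use C in blast)
  have L: "a \<in> L" "x \<in> L" "c \<in> L" unfolding L_def by (auto intro: generate.incl)
  have mL: "(p \<circ> q, (e + f) mod 2) \<in> L" if "(p, e) \<in> L" "(q, f) \<in> L" for p q e f
    using subgroup.m_closed[OF Ls that] by (simp only: mult_S4_Z2)
  have t12: "(tau 1 2, 0) \<in> L" using L(1) a_def by simp
  have t23: "(tau 2 3, 0) \<in> L"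
  proof -
    have "tau 1 2 \<circ> (tau 1 2 \<circ> tau 2 3) = tau 2 3" by (simp add: comp_assoc[symmetric])
    then show ?thesis using mL[OF t12, of "tau 1 2 \<circ> tau 2 3" 0] L(2) x_def by simp
  qed
  have t13: "(tau 1 3, 0) \<in> L"
  proof -
    have "tau 1 2 \<circ> (tau 2 3 \<circ> tau 1 2) = tau 1 3" by (rule fun_eq_4; simp add: transpose_def)
    then show ?thesis using mL[OF t12 mL[OF t23 t12]] by simp
  qed
  have t34': "(tau 3 4, 1) \<in> L"
  proof -
    have "tau 1 2 \<circ> (tau 1 2 \<circ> tau 3 4) = tau 3 4" by (simp add: comp_assoc[symmetric])
    then show ?thesis using mL[OF t12, of "tau 1 2 \<circ> tau 3 4" 1] L(3) c_def by simp
  qed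
  have t14': "(tau 1 4, 1) \<in> L"
  proof -
    have "tau 1 3 \<circ> (tau 3 4 \<circ> tau 1 3) = tau 1 4" by (rule fun_eq_4; simp add: transpose_def)
    then show ?thesis using mL[OF t13 mL[OF t34' t13]] by simp
  qed
  have t24': "(tau 2 4, 1) \<in> L"
  proof -
    have "tau 2 3 \<circ> (tau 3 4 \<circ> tau 2 3) = tau 2 4" by (rule fun_eq_4; simp add: transpose_def)
    then show ?thesis using mL[OF t23 mL[OF t34' t23]] by simp
  qed
  \<comment> \<open>Conjugating (2 4) by (1 4) gives (1 2), which the last factor cancels; the three
    odd flags leave 1. Multiplying by this central element then strips flags from the other
    transpositions.\<close>
  have z: "(id, 1) \<in> L"
  proof -
    have "tau 1 4 \<circ> (tau 2 4 \<circ> (tau 1 4 \<circ> tau 1 2)) = id" by (rule fun_eq_4; simp add: transpose_def)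
    then show ?thesis using mL[OF t14' mL[OF t24' mL[OF t14' t12]]] by simp
  qed
  have t0: "(tau i j, 0) \<in> L" if "(tau i j, 1) \<in> L" for i j using mL[OF z that] by simp
  have sym: "(tau i j, 0) \<in> L" if "(tau j i, 0) \<in> L" for i j
    using that by (simp add: transpose_commute)
  have id: "(id, 0) \<in> L" using subgroup.one_closed[OF Ls] by (simp only: one_S4_Z2)
  have t: "(tau i j, 0) \<in> L" if "i \<in> {1..4}" "j \<in> {1..4}" for i j
  proof -
    have "i = 1 \<or> i = 2 \<or> i = 3 \<or> i = 4" "j = 1 \<or> j = 2 \<or> j = 3 \<or> j = 4" using that by auto
    then show ?thesis
      using t12 t13 t0[OF t14'] t23 t0[OF t24'] t0[OF t34'] id
        sym[OF t12] sym[OF t13] sym[OF t0[OF t14']] sym[OF t23] sym[OF t0[OF t24']] sym[OF t0[OF t34']]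
      by (elim disjE) (simp_all only: transpose_same)
  qed
  have p0: "(p, 0) \<in> L" if "p permutes {1..4}" for p
    using that finite_atLeastAtMost
  proof (induction rule: permutes_induct)
    case id
    then show ?case by (rule \<open>(id, 0) \<in> L\<close>)
  next
    case (swap i j p)
    then show ?case using mL[OF t[OF swap.hyps(1,2)] swap.IH] by (simp add: comp_def)
  qed
  have "carrier S4_Z2 \<subseteq> L"
  proof
    fix u assume "u \<in> carrier S4_Z2"
    then obtain p e where u: "u = (p, e)" "p permutes {1..4}" "e = 0 \<or> e = 1"
      using mem_S4_Z2 by (cases u) blast
    then show "u \<in> L" using p0[OF u(2)] mL[OF z p0[OF u(2)]] by auto
  qed
  then have gen: "generate S4_Z2 {a, x, c} = carrier S4_Z2"
    using subgroup.subset[OF Ls] unfolding L_def by blast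
  show am: "D3_D2_amalgam S4_Z2 a x c"
  proof
    show "a \<otimes>\<^bsub>S4_Z2\<^esub> a = \<one>\<^bsub>S4_Z2\<^esub>" "c \<otimes>\<^bsub>S4_Z2\<^esub> c = \<one>\<^bsub>S4_Z2\<^esub>"
      "x \<otimes>\<^bsub>S4_Z2\<^esub> (x \<otimes>\<^bsub>S4_Z2\<^esub> x) = \<one>\<^bsub>S4_Z2\<^esub>"
      "a \<otimes>\<^bsub>S4_Z2\<^esub> c = c \<otimes>\<^bsub>S4_Z2\<^esub> a" "a \<otimes>\<^bsub>S4_Z2\<^esub> x = x \<otimes>\<^bsub>S4_Z2\<^esub> (x \<otimes>\<^bsub>S4_Z2\<^esub> a)"
      unfolding a_def x_def c_def mult_S4_Z2 one_S4_Z2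
      by ((intro Pair_eqI fun_eq_4; simp add: transpose_def)+)
  qed (use C gen finite_S4_Z2 in blast)+
  interpret A: D3_D2_amalgam S4_Z2 a x c by (rule am)
  show "c \<otimes>\<^bsub>S4_Z2\<^esub> (x \<otimes>\<^bsub>S4_Z2\<^esub> c \<otimes>\<^bsub>S4_Z2\<^esub> inv\<^bsub>S4_Z2\<^esub> x) = (x \<otimes>\<^bsub>S4_Z2\<^esub> c \<otimes>\<^bsub>S4_Z2\<^esub> inv\<^bsub>S4_Z2\<^esub> x) \<otimes>\<^bsub>S4_Z2\<^esub> c"
    unfolding A.invs unfolding a_def x_def c_def mult_S4_Z2 one_S4_Z2
    by ((intro Pair_eqI fun_eq_4; simp add: transpose_def)+)
qed

context D3_D2_amalgam
begin

lemma iso_S4_Z2_if_commute: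
  assumes "card (carrier G) = 48" "c \<otimes> c\<^sub>1 = c\<^sub>1 \<otimes> c"
  shows "G \<cong> S4_Z2"
  by (rule D3_D2_amalgam_iso[OF D3_D2_amalgam_axioms S4_Z2_amalgam(1) _ S4_Z2_amalgam(2)
        assms(1) card_S4_Z2]) (use assms(2) c\<^sub>1_def in simp)

text \<open>A Sylow 2-subgroup has order 16 and index 3, so its core has order 8 and is generated by
  the conjugates of \<open>c\<close>, or of \<open>a c\<close>. At order 8 these commute, and the
  comparison with the model applies.\<close>

theorem iso_S4_Z2:
  assumes c48: "card (carrier G) = 48"
  shows "G \<cong> S4_Z2"
proof -
  have "order G = 2 ^ 4 * 3" using c48 by (simp add: order_def)
  then obtain M where M: "subgroup M G" "card M = 16"
    using sylow_thm[of 2 G 4 3] fin is_group by auto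
  obtain L where L: "L \<lhd> G" "card (carrier G) = 6 * card L" "c \<in> L \<or> a \<otimes> c \<in> L"
    by (rule index_six_core[OF M(1)]) (simp add: M c48, blast)
  from L(3) show ?thesis
  proof
    assume "c \<in> L"
    then have "card W = 8" using W_eq_normal L c48 by simp
    then show ?thesis using iso_S4_Z2_if_commute[OF c48 commute_if_card_8] by simp
  next
    assume ac: "a \<otimes> c \<in> L"
    interpret A: D3_D2_amalgam G a x "a \<otimes> c" by (rule D3_D2_amalgam_ac)
    have "card A.W = 8" using A.W_eq_normal L ac c48 by simp
    then show ?thesis using A.iso_S4_Z2_if_commute[OF c48 A.commute_if_card_8] by simp
  qed
qed

end

subsection \<open>Amalgams of \<open>D\<^sub>3\<close> and \<open>A\<^sub>4\<close>\<close>

text \<open>Finite quotients of the amalgam of \<open>D\<^sub>3 = \<langle>s, y\<rangle>\<close> and \<open>V \<cong> A\<^sub>4\<close> over \<open>\<langle>y\<rangle>\<close>; the Klein four-subgroup of \<open>V\<close>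
  consists of its elements of order at most 2 and is \<open>{1, v, y v y\<inverse>, y\<^sup>2 v y\<^sup>-\<^sup>2}\<close>.\<close>

locale D3_A4_amalgam = group G for G (structure) +
  fixes V v y s
  assumes fin: "finite (carrier G)" and V: "subgroup V G" "card V = 12"
    and vV: "v \<in> V" and yV: "y \<in> V" and cs [simp]: "s \<in> carrier G"
    and y_ne: "y \<noteq> \<one>" and v_ne: "v \<noteq> \<one>"
    and y3: "y \<otimes> (y \<otimes> y) = \<one>" and ss: "s \<otimes> s = \<one>" and sy: "s \<otimes> y = y \<otimes> (y \<otimes> s)"
    and v_v1: "v \<otimes> (y \<otimes> v \<otimes> inv y) = y \<otimes> (y \<otimes> v \<otimes> inv y) \<otimes> inv y"
    and invol: "\<And>g. g \<in> V \<Longrightarrow> g \<otimes> g = \<one> \<longleftrightarrow>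
      g \<in> {\<one>, v, y \<otimes> v \<otimes> inv y, y \<otimes> (y \<otimes> v \<otimes> inv y) \<otimes> inv y}"
    and gen: "generate G (insert s V) = carrier G"
begin

definition v\<^sub>1 where "v\<^sub>1 = y \<otimes> v \<otimes> inv y"
definition v\<^sub>2 where "v\<^sub>2 = y \<otimes> v\<^sub>1 \<otimes> inv y"
definition E where "E = {\<one>, v, v\<^sub>1, v\<^sub>2}"

lemma cv [simp]: "v \<in> carrier G" and cy [simp]: "y \<in> carrier G"
  using vV yV subgroup.mem_carrier[OF V(1)] by auto

lemma cv12 [simp]: "v\<^sub>1 \<in> carrier G" "v\<^sub>2 \<in> carrier G"
  by (simp_all add: v\<^sub>1_def v\<^sub>2_def)

lemma v1_v2_V: "v\<^sub>1 \<in> V" "v\<^sub>2 \<in> V"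
proof -
  show "v\<^sub>1 \<in> V" unfolding v\<^sub>1_def
    using vV yV subgroup.m_closed[OF V(1)] subgroup.m_inv_closed[OF V(1)] by blast
  then show "v\<^sub>2 \<in> V" unfolding v\<^sub>2_def
    using yV subgroup.m_closed[OF V(1)] subgroup.m_inv_closed[OF V(1)] by blast
qed

text \<open>This criterion is invariant under conjugation. It yields normality of \<open>E\<close>
  in \<open>V\<close>, and later normality in \<open>G\<close> once the conjugate of
  \<open>E\<close> by \<open>s\<close> is suitably confined.\<close>

lemma mem_E_iff: "g \<in> E \<longleftrightarrow> g \<in> V \<and> g \<otimes> g = \<one>"
proof (cases "g \<in> V")
  case True
  then show ?thesis using invol unfolding E_def v\<^sub>2_def v\<^sub>1_def by blast
next
  case False
  then show ?thesis using v1_v2_V vV subgroup.one_closed[OF V(1)] unfolding E_def by blast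
qed

lemma EV: "E \<subseteq> V" using mem_E_iff by blast

lemma v_mult_v1: "v \<otimes> v\<^sub>1 = v\<^sub>2"
  using v_v1 by (simp add: v\<^sub>1_def v\<^sub>2_def)

lemma sq: "v \<otimes> v = \<one>" "v\<^sub>1 \<otimes> v\<^sub>1 = \<one>" "v\<^sub>2 \<otimes> v\<^sub>2 = \<one>"
  using mem_E_iff E_def by auto

lemma v_invs: "inv v = v" "inv v\<^sub>1 = v\<^sub>1" "inv v\<^sub>2 = v\<^sub>2" "inv s = s" "inv y = y \<otimes> y"
  by (rule inv_equality; simp add: sq ss m_assoc y3)+

lemma v1_mult_v: "v\<^sub>1 \<otimes> v = v\<^sub>2"
proof -
  have "inv (v \<otimes> v\<^sub>1) = v\<^sub>1 \<otimes> v" by (simp add: inv_mult_group v_invs)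
  then show ?thesis unfolding v_mult_v1 by (simp add: v_invs)
qed

lemma conj_y: "y \<otimes> v \<otimes> inv y = v\<^sub>1" "y \<otimes> v\<^sub>1 \<otimes> inv y = v\<^sub>2" "y \<otimes> v\<^sub>2 \<otimes> inv y = v"
proof -
  have "y \<otimes> v\<^sub>2 \<otimes> inv y = (y \<otimes> (y \<otimes> y)) \<otimes> v \<otimes> inv (y \<otimes> (y \<otimes> y))"
    by (simp add: v\<^sub>2_def v\<^sub>1_def m_assoc inv_mult_group)
  then show "y \<otimes> v\<^sub>2 \<otimes> inv y = v" by (simp add: y3)
qed (simp_all add: v\<^sub>1_def v\<^sub>2_def)

lemma ne: "v\<^sub>1 \<noteq> \<one>" "v\<^sub>2 \<noteq> \<one>" "v \<noteq> v\<^sub>1"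
proof -
  have c: "g = \<one>" if "g \<in> carrier G" "y \<otimes> g \<otimes> inv y = \<one>" for g
  proof -
    have "inv y \<otimes> (y \<otimes> g \<otimes> inv y) \<otimes> y = \<one>" using that by simp
    then show ?thesis using that(1) by (simp add: m_assoc inv_cancel_left)
  qed
  show 1: "v\<^sub>1 \<noteq> \<one>" using c[of v] v_ne unfolding v\<^sub>1_def by auto
  then show 2: "v\<^sub>2 \<noteq> \<one>" using c[of v\<^sub>1] unfolding v\<^sub>2_def by auto
  then show "v \<noteq> v\<^sub>1" using v_mult_v1 sq by auto
qed

lemma subgroup_E: "subgroup E G" and card_E: "card E = 4"
proof -
  have "E = {\<one>, v, v\<^sub>1, v \<otimes> v\<^sub>1}" unfolding E_def v_mult_v1 ..
  then show "subgroup E G"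
    using subgroup_klein[of v v\<^sub>1] by (simp add: sq v_mult_v1 v1_mult_v)
  have "v\<^sub>2 \<noteq> v" using v_mult_v1 ne by auto
  moreover have "v\<^sub>2 \<noteq> v\<^sub>1" using v1_mult_v v_ne by auto
  ultimately show "card E = 4" unfolding E_def using v_ne ne by auto
qed

lemma y_pow: "y [^] (3::nat) = \<one>"
  by (simp add: numeral_3_eq_3 m_assoc y3)

text \<open>The order of the generated subgroup is divisible by 4 and by 3, hence is at least
  12.\<close>

lemma V_eq: "V = generate G (insert y E)"
proof -
  have sub: "insert y E \<subseteq> carrier G" by (auto simp: E_def)
  have s: "subgroup (generate G (insert y E)) G" by (rule generate_is_subgroup[OF sub])
  have inV: "generate G (insert y E) \<subseteq> V"
    by (rule generate_subgroup_incl[OF _ V(1)]) (use EV yV in auto)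
  have m: "y \<in> generate G (insert y E)" "E \<subseteq> generate G (insert y E)" by (auto intro: generate.incl)
  have "4 dvd card (generate G (insert y E))"
    using card_dvd_subgroup[OF fin s subgroup_E m(2)] card_E by simp
  moreover have "{\<one>, y, y \<otimes> y} \<subseteq> generate G (insert y E)"
    using m(1) subgroup.one_closed[OF s] subgroup.m_closed[OF s] by blast
  then have "3 dvd card (generate G (insert y E))"
    using card_dvd_subgroup[OF fin s subgroup_order_3(1)[OF cy y3 y_ne]]
      subgroup_order_3(2)[OF cy y3 y_ne] by metis
  moreover have "0 < card (generate G (insert y E))"
    by (rule subgroup.finite_imp_card_positive[OF s fin])
  ultimately have "12 \<le> card (generate G (insert y E))" by presburger
  then show ?thesis using inV V(2) finite_subgroup[OF fin V(1)] card_seteq by metis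
qed

lemma E_normal_V: "E \<lhd> G\<lparr>carrier := V\<rparr>"
proof (rule normal_in_subgroupI[OF V(1) subgroup_E EV])
  fix h k assume h: "h \<in> V" and k: "k \<in> E"
  have c: "h \<in> carrier G" "k \<in> carrier G" using h k EV subgroup.mem_carrier[OF V(1)] by auto
  have kk: "k \<otimes> k = \<one>" using k mem_E_iff by blast
  have "h \<otimes> k \<otimes> inv h \<in> V"
    using h k EV subgroup.m_closed[OF V(1)] subgroup.m_inv_closed[OF V(1)] by blast
  moreover have "(h \<otimes> k \<otimes> inv h) \<otimes> (h \<otimes> k \<otimes> inv h) = \<one>"
  proof -
    have "(h \<otimes> k \<otimes> inv h) \<otimes> (h \<otimes> k \<otimes> inv h) = h \<otimes> (k \<otimes> k) \<otimes> inv h"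
      using c by (simp add: m_assoc inv_cancel_left)
    then show ?thesis using kk c by simp
  qed
  ultimately show "h \<otimes> k \<otimes> inv h \<in> E" using mem_E_iff by blast
qed

text \<open>It suffices to confine \<open>s E s\<inverse>\<close> to a set all of whose elements of order at most 2 lie in \<open>E\<close>:
  then \<open>E\<close> is normal in \<open>G\<close>, and \<open>G/E\<close> is a quotient of \<open>D\<^sub>3\<close>.\<close>

lemma card_le_24:
  assumes M: "\<And>e. e \<in> E \<Longrightarrow> s \<otimes> e \<otimes> inv s \<in> M" "\<And>g. g \<in> M \<Longrightarrow> g \<otimes> g = \<one> \<Longrightarrow> g \<in> E"
  shows "card (carrier G) \<le> 24"
proof -
  have EC: "E \<subseteq> carrier G" by (auto simp: E_def)
  have sE: "s \<otimes> e \<otimes> inv s \<in> E" if e: "e \<in> E" for e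
  proof (rule M(2)[OF M(1)[OF e]])
    have "(s \<otimes> e \<otimes> inv s) \<otimes> (s \<otimes> e \<otimes> inv s) = s \<otimes> (e \<otimes> e) \<otimes> inv s"
      using e EC by (simp add: subset_iff m_assoc inv_cancel_left)
    then show "(s \<otimes> e \<otimes> inv s) \<otimes> (s \<otimes> e \<otimes> inv s) = \<one>" using e mem_E_iff by simp
  qed
  have sub: "insert y E \<subseteq> carrier G" using EC by simp
  have "card (generate G (insert s (insert y E))) \<le> 2 * card (generate G (insert y E))"
  proof (rule card_generate_insert_le[OF fin sub cs])
    fix h assume h: "h \<in> insert y E"
    show "s \<otimes> h \<otimes> inv s \<in> generate G (insert y E)"
    proof (cases "h = y")
      case True
      have "s \<otimes> y \<otimes> inv s = y \<otimes> y" by (simp add: sy v_invs m_assoc ss)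
      then show ?thesis using True by (auto intro: generate.intros)
    next
      case False
      then show ?thesis using h sE by (auto intro: generate.incl)
    qed
  qed (simp_all add: numeral_2_eq_2 ss)
  moreover have "generate G (insert s (insert y E)) = carrier G"
  proof
    have sub': "insert s (insert y E) \<subseteq> carrier G" using sub by simp
    show "generate G (insert s (insert y E)) \<subseteq> carrier G" by (rule generate_incl[OF sub'])
    have "V \<subseteq> generate G (insert s (insert y E))"
      unfolding V_eq by (rule mono_generate) blast
    then have "insert s V \<subseteq> generate G (insert s (insert y E))" by (auto intro: generate.incl)
    from generate_subgroup_incl[OF this generate_is_subgroup[OF sub']]
    show "carrier G \<subseteq> generate G (insert s (insert y E))" using gen by simp
  qed
  ultimately show ?thesis using V(2) V_eq by simp
qed

text \<open>\<open>y\<close> permutes the three involutions of \<open>E\<close> cyclically, so one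
  of them in \<open>N\<close> brings in the others.\<close>

lemma E_subset_normal:
  assumes N: "N \<lhd> G" and e: "e \<in> E" "e \<in> N" "e \<noteq> \<one>"
  shows "E \<subseteq> N"
proof -
  have Ny: "y \<otimes> u \<otimes> inv y \<in> N" if "u \<in> N" for u by (rule normal.inv_op_closed2[OF N cy that])
  have r: "v \<in> N \<Longrightarrow> v\<^sub>1 \<in> N" "v\<^sub>1 \<in> N \<Longrightarrow> v\<^sub>2 \<in> N" "v\<^sub>2 \<in> N \<Longrightarrow> v \<in> N"
    using Ny conj_y by metis+
  have "v \<in> N" using e r unfolding E_def by blast
  then show ?thesis unfolding E_def using r subgroup.one_closed[OF normal_imp_subgroup[OF N]] by blast
qed

text \<open>The commutator of \<open>y\<close> and \<open>v\<close> is
  \<open>v\<^sub>1 v = v\<^sub>2\<close>, and a normal subgroup contains every commutator with one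
  of its elements.\<close>

lemma v2_mem_if_y_mem:
  assumes N: "N \<lhd> G" and y: "y \<in> N"
  shows "v\<^sub>2 \<in> N"
proof -
  have Ns: "subgroup N G" by (rule normal_imp_subgroup[OF N])
  have "y \<otimes> (v \<otimes> inv y \<otimes> inv v) \<in> N"
    using y normal.inv_op_closed2[OF N cv subgroup.m_inv_closed[OF Ns y]] subgroup.m_closed[OF Ns]
    by blast
  moreover have "y \<otimes> (v \<otimes> inv y \<otimes> inv v) = v\<^sub>1 \<otimes> v"
    by (simp add: v\<^sub>1_def m_assoc v_invs(1))
  ultimately show ?thesis by (simp add: v1_mult_v)
qed

lemma Y_Int:
  assumes "subgroup N G" "y \<notin> N"
  shows "{\<one>, y, y \<otimes> y} \<inter> N = {\<one>}"
proof -
  have "y \<otimes> y \<notin> N"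
  proof
    assume "y \<otimes> y \<in> N"
    then have "inv (y \<otimes> y) \<in> N" by (rule subgroup.m_inv_closed[OF assms(1)])
    moreover have "inv (y \<otimes> y) = y" using y3 by (intro inv_equality) auto
    ultimately show False using assms by simp
  qed
  then show ?thesis using assms subgroup.one_closed[OF assms(1)] by blast
qed

text \<open>The group of order 3 generated by \<open>y\<close> meets \<open>N\<close> trivially, so
  together they span a subgroup of \<open>V\<close> of order 3 |N|.\<close>

lemma three_mult_card_dvd_12:
  assumes N: "N \<lhd> G" "N \<subseteq> V" "y \<notin> N"
  shows "3 * card N dvd 12"
proof -
  interpret V: group "G\<lparr>carrier := V\<rparr>" by (rule subgroup_as_group(1)[OF V(1)])
  have Ns: "subgroup N G" by (rule normal_imp_subgroup[OF N(1)])
  have fV: "finite (carrier (G\<lparr>carrier := V\<rparr>))" using finite_subgroup[OF fin V(1)] by simp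
  have NV: "N \<lhd> G\<lparr>carrier := V\<rparr>"
    by (rule normal_in_subgroupI[OF V(1) Ns N(2)])
      (rule normal.inv_op_closed2[OF N(1)], auto intro: subgroup.mem_carrier[OF V(1)])
  have "{\<one>, y, y \<otimes> y} \<subseteq> V"
    using yV subgroup.one_closed[OF V(1)] subgroup.m_closed[OF V(1)] by blast
  from subgroup_as_group(2)[OF V(1) subgroup_order_3(1)[OF cy y3 y_ne] this]
  have YV: "subgroup {\<one>, y, y \<otimes> y} (G\<lparr>carrier := V\<rparr>)" .
  show ?thesis
    using V.set_mult_disjoint_normal(3)[OF fV NV YV] Y_Int[OF Ns N(3)]
      subgroup_order_3(2)[OF cy y3 y_ne] V(2) by simp
qed

text \<open>The core \<open>N\<close> of \<open>V\<close> has order at least 48/4! = 2. If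
  \<open>y\<close> is in \<open>N\<close>, a commutator lies in \<open>E\<close> and in
  \<open>N\<close>. Otherwise |N| divides 4, so a nontrivial element of \<open>N\<close> has order
  prime to the index 3 of \<open>E\<close> in \<open>V\<close> and lies in \<open>E\<close>. Either
  way \<open>E\<close> is inside \<open>N\<close>, and conjugation by \<open>s\<close> keeps it
  inside \<open>V\<close>.\<close>

theorem card_ne_48: "card (carrier G) \<noteq> 48"
proof
  assume c48: "card (carrier G) = 48"
  obtain N where N: "N \<lhd> G" "N \<subseteq> V" "card (carrier G) \<le> fact (card (rcosets V)) * card N"
    by (rule normal_core[OF fin V(1)]) blast
  have Ns: "subgroup N G" by (rule normal_imp_subgroup[OF N(1)])
  have "card (rcosets V) = 4" by (rule card_rcosets_eq[OF fin V(1)]) (simp add: c48 V)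
  then have N2: "2 \<le> card N" using N(3) c48 by (simp add: fact_numeral)
  have EN: "E \<subseteq> N"
  proof (cases "y \<in> N")
    case True
    then show ?thesis using E_subset_normal[OF N(1), of v\<^sub>2] v2_mem_if_y_mem[OF N(1)] ne by (simp add: E_def)
  next
    case False
    have "3 * card N dvd 3 * 4" using three_mult_card_dvd_12[OF N(1,2) False] by simp
    then have N4: "card N dvd 4" by (simp only: nat_mult_dvd_cancel_disj) simp
    have "N \<noteq> {\<one>}" using N2 by auto
    then obtain g where g: "g \<in> N" "g \<noteq> \<one>" using subgroup.one_closed[OF Ns] by blast
    have "g [^] card N = \<one>" by (rule pow_card_subgroup[OF fin Ns g(1)])
    moreover have "coprime (card N) 3"
    proof -
      have "coprime (4::nat) 3" using coprime_power_left_iff[of "2::nat" 2 3] by simp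
      then show ?thesis using coprime_divisors[OF N4 dvd_refl] by blast
    qed
    ultimately have "g \<in> E"
      using coprime_index_mem_subgroup[OF fin V(1) E_normal_V, of g "card N" 3] g N(2) V(2) card_E by auto
    then show ?thesis using E_subset_normal[OF N(1)] g by blast
  qed
  have "card (carrier G) \<le> 24"
  proof (rule card_le_24)
    show "s \<otimes> e \<otimes> inv s \<in> N" if "e \<in> E" for e
      using normal.inv_op_closed2[OF N(1) cs] that EN by blast
    show "g \<in> E" if "g \<in> N" "g \<otimes> g = \<one>" for g using that N(2) mem_E_iff by blast
  qed
  then show False using c48 by simp
qed

text \<open>If |K| = 9, then \<open>K\<close> contains \<open>y\<close> and therefore the involution
  \<open>v\<^sub>2\<close>, against odd order. If |K| = 3, then \<open>V\<close> centralizes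
  \<open>K\<close> and meets it trivially, so their product is direct, of order 36, and its elements
  of square 1 are those of \<open>E\<close>.\<close>

theorem card_ne_72: "card (carrier G) \<noteq> 72"
proof
  assume c72: "card (carrier G) = 72"
  obtain K where K: "K \<lhd> G" "card K = 9 \<or> card K = 3"
    using order_72_normal_3_subgroup[OF fin c72] .
  have Ks: "subgroup K G" by (rule normal_imp_subgroup[OF K(1)])
  note KC = subgroup.mem_carrier[OF Ks]
  from K(2) show False
  proof
    assume K9: "card K = 9"
    have "y \<in> K"
      by (rule coprime_index_mem[OF fin K(1) cy y_pow, of 8]) (simp_all add: c72 K9 coprime_3_8)
    then have vK: "v\<^sub>2 \<in> K" by (rule v2_mem_if_y_mem[OF K(1)])
    have "card {\<one>, v\<^sub>2} = 2" using ne by simp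
    then have "{\<one>, v\<^sub>2} \<inter> K = {\<one>}"
      by (intro coprime_card_Int_trivial[OF fin subgroup_pair[OF cv12(2) sq(3)] Ks]) (simp add: K9)
    then show False using vK ne by auto
  next
    assume K3: "card K = 3"
    define C where "C = {g \<in> carrier G. \<forall>k\<in>K. g \<otimes> k \<otimes> inv g = k}"
    have Cs: "subgroup C G"
    proof (rule subgroupI)
      show "C \<subseteq> carrier G" unfolding C_def by blast
      have "\<one> \<in> C" unfolding C_def using KC by simp
      then show "C \<noteq> {}" by blast
      show "inv g \<in> C" if g: "g \<in> C" for g
      proof -
        have gC: "g \<in> carrier G" using g C_def by blast
        have "inv g \<otimes> k \<otimes> inv (inv g) = k" if k: "k \<in> K" for k
        proof -
          have "g \<otimes> k \<otimes> inv g = k" using g k C_def by blast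
          then have "inv g \<otimes> k \<otimes> inv (inv g) = inv g \<otimes> (g \<otimes> k \<otimes> inv g) \<otimes> inv (inv g)" by simp
          then show ?thesis using gC KC[OF k] by (simp add: m_assoc inv_cancel_left)
        qed
        then show ?thesis unfolding C_def using gC by blast
      qed
      show "g \<otimes> h \<in> C" if g: "g \<in> C" and h: "h \<in> C" for g h
      proof -
        have gC: "g \<in> carrier G" "h \<in> carrier G" using g h C_def by blast+
        have "g \<otimes> h \<otimes> k \<otimes> inv (g \<otimes> h) = k" if k: "k \<in> K" for k
        proof -
          have "g \<otimes> h \<otimes> k \<otimes> inv (g \<otimes> h) = g \<otimes> (h \<otimes> k \<otimes> inv h) \<otimes> inv g"
            using gC KC[OF k] by (simp add: m_assoc inv_mult_group)
          also have "h \<otimes> k \<otimes> inv h = k" using h k C_def by blast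
          also have "g \<otimes> k \<otimes> inv g = k" using g k C_def by blast
          finally show ?thesis .
        qed
        then show ?thesis unfolding C_def using gC by blast
      qed
    qed
    have yC: "y \<in> C" unfolding C_def
      using order_3_centralizes_normal_order_3[OF fin K(1) K3 cy y3] by simp
    have v2C: "v\<^sub>2 \<in> C"
    proof -
      have "v\<^sub>2 \<otimes> k \<otimes> inv v\<^sub>2 = k" if k: "k \<in> K" for k
      proof -
        \<comment> \<open>\<open>v\<^sub>1\<close> is the conjugate of \<open>v\<close> by
          \<open>y\<close>, and \<open>y\<close> centralizes \<open>K\<close>, so both act alike on
          \<open>K\<close>. Hence \<open>v\<^sub>2 = v v\<^sub>1\<close> acts as the square of
          \<open>v\<close>, that is trivially.\<close>
        have act: "v\<^sub>1 \<otimes> k \<otimes> inv v\<^sub>1 = v \<otimes> k \<otimes> inv v" if k: "k \<in> K" for k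
        proof -
          have iy: "inv y \<in> C" by (rule subgroup.m_inv_closed[OF Cs yC])
          have "v\<^sub>1 \<otimes> k \<otimes> inv v\<^sub>1 = y \<otimes> (v \<otimes> (inv y \<otimes> k \<otimes> inv (inv y)) \<otimes> inv v) \<otimes> inv y"
            using KC[OF k] by (simp add: v\<^sub>1_def m_assoc inv_mult_group)
          also have "inv y \<otimes> k \<otimes> inv (inv y) = k" using iy k C_def by blast
          also have "y \<otimes> (v \<otimes> k \<otimes> inv v) \<otimes> inv y = v \<otimes> k \<otimes> inv v"
            using yC normal.inv_op_closed2[OF K(1) cv k] C_def by blast
          finally show ?thesis .
        qed
        have "v\<^sub>2 \<otimes> k \<otimes> inv v\<^sub>2 = v \<otimes> (v\<^sub>1 \<otimes> k \<otimes> inv v\<^sub>1) \<otimes> inv v"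
          using KC[OF k] by (simp add: v_mult_v1[symmetric] m_assoc inv_mult_group)
        also have "\<dots> = (v \<otimes> v) \<otimes> k \<otimes> inv (v \<otimes> v)"
          unfolding act[OF k] using KC[OF k] by (simp add: m_assoc inv_mult_group)
        also have "\<dots> = k" unfolding sq using KC[OF k] by simp
        finally show ?thesis .
      qed
      then show ?thesis unfolding C_def by simp
    qed
    have conjC: "y \<otimes> u \<otimes> inv y \<in> C" if "u \<in> C" for u
      using that yC subgroup.m_closed[OF Cs] subgroup.m_inv_closed[OF Cs] by blast
    have vC: "v \<in> C" using conjC[OF v2C] conj_y by simp
    have v1C: "v\<^sub>1 \<in> C" using conjC[OF vC] conj_y by simp
    have VC: "V \<subseteq> C" unfolding V_eq
      by (rule generate_subgroup_incl[OF _ Cs])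
        (use yC vC v1C v2C subgroup.one_closed[OF Cs] in \<open>auto simp: E_def\<close>)
    \<comment> \<open>Otherwise \<open>v\<close>, which centralizes \<open>K\<close>, commutes with
      \<open>y\<close>, and the commutator \<open>v\<^sub>2\<close> would be trivial.\<close>
    have yK: "y \<notin> K"
    proof
      assume "y \<in> K"
      then have e: "v \<otimes> y \<otimes> inv v = y" using vC C_def by blast
      have "v\<^sub>1 \<otimes> inv v = y \<otimes> inv (v \<otimes> y \<otimes> inv v)"
        by (simp add: v\<^sub>1_def m_assoc inv_mult_group)
      also have "\<dots> = \<one>" unfolding e by simp
      finally show False using ne(2) by (simp add: v_invs v1_mult_v)
    qed
    have VK: "V \<inter> K = {\<one>}"
    proof -
      have s: "subgroup (V \<inter> K) G" by (rule subgroups_Inter_pair[OF V(1) Ks])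
      have "card (V \<inter> K) dvd 3" using card_dvd_subgroup[OF fin Ks s] K3 by simp
      then have "card (V \<inter> K) = 1 \<or> card (V \<inter> K) = 3" by (rule nat_dvd_3)
      moreover have "card (V \<inter> K) \<noteq> 3"
      proof
        assume "card (V \<inter> K) = 3"
        then have "V \<inter> K = K" using K3 finite_subgroup[OF fin Ks] by (simp add: card_subset_eq)
        then have "K \<subseteq> V" by blast
        from three_mult_card_dvd_12[OF K(1) this yK] show False using K3 by simp
      qed
      ultimately show ?thesis using card_1_eq_singleton[OF _ subgroup.one_closed[OF s]] by blast
    qed
    define M where "M = V <#> K"
    have M: "subgroup M G" "card M = 36" unfolding M_def
      using set_mult_disjoint_normal[OF fin K(1) V(1) VK] V(2) K3 by auto
    have Mn: "M \<lhd> G" by (rule index_two_normal[OF fin M(1)]) (simp add: M c72)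
    have EM: "E \<subseteq> M"
    proof
      fix e assume e: "e \<in> E"
      then have "e \<otimes> \<one> \<in> M" unfolding M_def set_mult_def using EV subgroup.one_closed[OF Ks] by blast
      then show "e \<in> M" using e EV subgroup.mem_carrier[OF V(1)] by (simp add: subset_iff)
    qed
    have "card (carrier G) \<le> 24"
    proof (rule card_le_24)
      show "s \<otimes> e \<otimes> inv s \<in> M" if "e \<in> E" for e
        using normal.inv_op_closed2[OF Mn cs] that EM by blast
      show "g \<in> E" if g: "g \<in> M" "g \<otimes> g = \<one>" for g
      proof -
        obtain w k where wk: "w \<in> V" "k \<in> K" "g = w \<otimes> k" using g(1) unfolding M_def set_mult_def by blast
        have c: "w \<in> carrier G" "k \<in> carrier G" using wk KC subgroup.mem_carrier[OF V(1)] by auto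
        have "w \<otimes> k \<otimes> inv w = k" using wk VC C_def by blast
        then have "w \<otimes> k \<otimes> inv w \<otimes> w = k \<otimes> w" by simp
        then have com: "w \<otimes> k = k \<otimes> w" using c by (simp add: m_assoc)
        have "(w \<otimes> w) \<otimes> (k \<otimes> k) = w \<otimes> (w \<otimes> k) \<otimes> k" using c by (simp add: m_assoc)
        also have "\<dots> = w \<otimes> (k \<otimes> w) \<otimes> k" by (simp only: com)
        also have "\<dots> = g \<otimes> g" using c wk by (simp add: m_assoc)
        finally have "(w \<otimes> w) \<otimes> (k \<otimes> k) = \<one>" using g by simp
        \<comment> \<open>The factors commute, so the square of \<open>w\<close> is the inverse of
          the square of \<open>k\<close> and lies in the trivial intersection of \<open>V\<close>
          and \<open>K\<close>. Both squares are then 1, and \<open>k\<close>, whose cube is 1,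
          vanishes.\<close>
        then have ww: "w \<otimes> w = inv (k \<otimes> k)" using c by (intro inv_equality[symmetric]) auto
        have "w \<otimes> w \<in> V" using wk subgroup.m_closed[OF V(1)] by blast
        moreover have "w \<otimes> w \<in> K" unfolding ww
          using wk subgroup.m_closed[OF Ks] subgroup.m_inv_closed[OF Ks] by blast
        ultimately have w1: "w \<otimes> w = \<one>" using VK by blast
        then have "inv (k \<otimes> k) = \<one>" using ww by simp
        then have "k \<otimes> k = \<one>" using c by simp
        moreover have "k \<otimes> (k \<otimes> k) = \<one>"
          using pow_card_subgroup[OF fin Ks wk(2)] K3 c by (simp add: numeral_3_eq_3 m_assoc)
        ultimately have "k = \<one>" using c by simp
        then show "g \<in> E" using w1 wk c mem_E_iff by simp
      qed
    qed
    then show False using c72 by simp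
  qed
qed

end

subsection \<open>Generators from the isomorphism types\<close>

lemma (in group) iso_subgroup_facts:
  assumes U: "subgroup U G" and f: "f \<in> iso (G\<lparr>carrier := U\<rparr>) H" and H: "group H"
  shows "\<And>u w. u \<in> U \<Longrightarrow> w \<in> U \<Longrightarrow> f (u \<otimes> w) = f u \<otimes>\<^bsub>H\<^esub> f w"
    and "f \<one> = \<one>\<^bsub>H\<^esub>" and "inj_on f U" and "f ` U = carrier H"
proof -
  have h: "f \<in> hom (G\<lparr>carrier := U\<rparr>) H" and b: "bij_betw f U (carrier H)"
    using f by (simp_all add: iso_def)
  show "\<And>u w. u \<in> U \<Longrightarrow> w \<in> U \<Longrightarrow> f (u \<otimes> w) = f u \<otimes>\<^bsub>H\<^esub> f w"
    using h by (simp add: hom_def)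
  show "f \<one> = \<one>\<^bsub>H\<^esub>" using hom_one[OF h subgroup_imp_group[OF U] H] by simp
  show "inj_on f U" "f ` U = carrier H" using b by (simp_all add: bij_betw_def)
qed

lemma carrier_dihedral: "carrier (dihedral_group n) = {0..<int n} \<times> UNIV"
  and mult_dihedral: "(i, b) \<otimes>\<^bsub>dihedral_group n\<^esub> (j, d) = ((i + (if b then - j else j)) mod int n, b \<noteq> d)"
  and one_dihedral: "\<one>\<^bsub>dihedral_group n\<^esub> = (0, False)"
  by (simp_all add: dihedral_group_def)

lemma group_dihedral: "0 < n \<Longrightarrow> group (dihedral_group n)"
proof (rule groupI)
  assume n: "0 < n"
  show "\<one>\<^bsub>dihedral_group n\<^esub> \<in> carrier (dihedral_group n)"
    using n by (simp add: carrier_dihedral one_dihedral)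
  fix u assume u: "u \<in> carrier (dihedral_group n)"
  obtain i b where ib: "u = (i, b)" "0 \<le> i" "i < int n" using u by (auto simp: carrier_dihedral)
  show "\<one>\<^bsub>dihedral_group n\<^esub> \<otimes>\<^bsub>dihedral_group n\<^esub> u = u"
    using ib by (simp add: one_dihedral mult_dihedral)
  show "\<exists>w\<in>carrier (dihedral_group n). w \<otimes>\<^bsub>dihedral_group n\<^esub> u = \<one>\<^bsub>dihedral_group n\<^esub>"
    \<comment> \<open>A reflection is its own inverse; for a rotation the exponent is negated modulo
      \<open>n\<close>.\<close>
    by (rule bexI[of _ "(if b then i else (- i) mod int n, b)"])
      (use ib n in \<open>auto simp: carrier_dihedral mult_dihedral one_dihedral mod_add_left_eq\<close>)
  fix w assume w: "w \<in> carrier (dihedral_group n)"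
  obtain j d where jd: "w = (j, d)" using w by (auto simp: carrier_dihedral)
  show "u \<otimes>\<^bsub>dihedral_group n\<^esub> w \<in> carrier (dihedral_group n)"
    using n ib jd by (simp add: carrier_dihedral mult_dihedral)
  fix z assume "z \<in> carrier (dihedral_group n)"
  obtain k e where ke: "z = (k, e)" by (cases z) auto
  show "u \<otimes>\<^bsub>dihedral_group n\<^esub> w \<otimes>\<^bsub>dihedral_group n\<^esub> z = u \<otimes>\<^bsub>dihedral_group n\<^esub> (w \<otimes>\<^bsub>dihedral_group n\<^esub> z)"
    unfolding ib(1) jd ke mult_dihedral
    by (cases b; cases d) (simp_all add: mod_simps algebra_simps)
qed

context group
begin

lemma card_dihedral_subgroup:
  assumes "subgroup U G" "f \<in> iso (G\<lparr>carrier := U\<rparr>) (dihedral_group n)" "0 < n"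
  shows "card U = 2 * n"
proof -
  have "card U = card (carrier (dihedral_group n))"
    using iso_subgroup_facts(3,4)[OF assms(1,2) group_dihedral[OF assms(3)]] card_image by metis
  then show ?thesis by (simp add: carrier_dihedral card_cartesian_product)
qed

text \<open>Both 2 and 3 divide the order of the generated subgroup, which is therefore at least
  6.\<close>

lemma generate_involution_order_3:
  assumes fin: "finite (carrier G)" and U: "subgroup U G" "card U = 6"
    and a: "a \<in> U" "a \<otimes> a = \<one>" "a \<noteq> \<one>" and x: "x \<in> U" "x \<otimes> (x \<otimes> x) = \<one>" "x \<noteq> \<one>"
  shows "generate G {a, x} = U"
proof -
  have c: "a \<in> carrier G" "x \<in> carrier G" using a x subgroup.mem_carrier[OF U(1)] by auto
  have s: "subgroup (generate G {a, x}) G" by (rule generate_is_subgroup) (use c in simp)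
  have sub: "generate G {a, x} \<subseteq> U" by (rule generate_subgroup_incl[OF _ U(1)]) (use a x in simp)
  have m: "a \<in> generate G {a, x}" "x \<in> generate G {a, x}" by (auto intro: generate.incl)
  have "{\<one>, a} \<subseteq> generate G {a, x}" "{\<one>, x, x \<otimes> x} \<subseteq> generate G {a, x}"
    using m subgroup.one_closed[OF s] subgroup.m_closed[OF s] by blast+
  moreover have "card {\<one>, a} = 2" using a by auto
  ultimately have "2 dvd card (generate G {a, x})" "3 dvd card (generate G {a, x})"
    using card_dvd_subgroup[OF fin s subgroup_pair[OF c(1) a(2)]]
      card_dvd_subgroup[OF fin s subgroup_order_3(1)[OF c(2) x(2,3)]]
      subgroup_order_3(2)[OF c(2) x(2,3)] by metis+
  moreover have "0 < card (generate G {a, x})" by (rule subgroup.finite_imp_card_positive[OF s fin])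
  ultimately have "6 \<le> card (generate G {a, x})" by presburger
  then show ?thesis using sub U(2) finite_subgroup[OF fin U(1)] card_seteq by metis
qed

text \<open>An involution of the dihedral group of order 6 is a reflection: a rotation exponent i
  with 2 i = 0 modulo 3 vanishes. The preimage of the basic rotation then serves as
  \<open>x\<close>, whichever reflection \<open>a\<close> is.\<close>

lemma D3_involution:
  assumes fin: "finite (carrier G)" and U: "subgroup U G" and iso: "G\<lparr>carrier := U\<rparr> \<cong> dihedral_group 3"
    and a: "a \<in> U" "a \<otimes> a = \<one>" "a \<noteq> \<one>"
  obtains x where "x \<in> U" "x \<otimes> (x \<otimes> x) = \<one>" "a \<otimes> x = x \<otimes> (x \<otimes> a)" "generate G {a, x} = U"
proof -
  obtain f where f: "f \<in> iso (G\<lparr>carrier := U\<rparr>) (dihedral_group 3)" using iso by (auto simp: is_iso_def)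
  note F = iso_subgroup_facts[OF U f group_dihedral[of 3, simplified]]
  note UC = subgroup.m_closed[OF U]
  obtain i b where ib: "f a = (i, b)" "0 \<le> i" "i < 3"
    using imageI[OF a(1), of f] unfolding F(4) by (cases "f a") (simp add: carrier_dihedral)
  have b: b
  proof (rule ccontr)
    assume "\<not> b"
    then have "f (a \<otimes> a) = ((i + i) mod 3, False)" using F(1)[OF a(1) a(1)] ib by (simp add: mult_dihedral)
    then have "(i + i) mod 3 = 0" using a(2) F(2) by (simp add: one_dihedral)
    then have "i = 0" using ib by presburger
    then have "f a = f \<one>" using ib \<open>\<not> b\<close> F(2) by (simp add: one_dihedral)
    then show False using inj_onD[OF F(3)] a subgroup.one_closed[OF U] by blast
  qed
  have "(1, False) \<in> f ` U" unfolding F(4) by (simp add: carrier_dihedral)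
  then obtain x where x: "x \<in> U" "f x = (1, False)" by (metis imageE)
  have "x \<otimes> (x \<otimes> x) = \<one>"
    by (rule inj_onD[OF F(3)]) (use x UC subgroup.one_closed[OF U] F in \<open>simp_all add: mult_dihedral one_dihedral\<close>)
  moreover have "a \<otimes> x = x \<otimes> (x \<otimes> a)"
    by (rule inj_onD[OF F(3)]) (use x a UC F(1) ib b in \<open>simp_all add: mult_dihedral, presburger\<close>)
  moreover have "x \<noteq> \<one>" using x F(2) by (auto simp: one_dihedral)
  ultimately show thesis
    using that[OF x(1)] generate_involution_order_3[OF fin U _ a x(1)] card_dihedral_subgroup[OF U f] by simp
qed

text \<open>The cube of a reflection is again a reflection, so \<open>y\<close> must be a rotation.
  The preimage of the reflection with exponent 0 serves as \<open>s\<close> and inverts it.\<close>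

lemma D3_rotation:
  assumes fin: "finite (carrier G)" and U: "subgroup U G" and iso: "G\<lparr>carrier := U\<rparr> \<cong> dihedral_group 3"
    and y: "y \<in> U" "y \<otimes> (y \<otimes> y) = \<one>" "y \<noteq> \<one>"
  obtains s where "s \<in> U" "s \<otimes> s = \<one>" "s \<otimes> y = y \<otimes> (y \<otimes> s)" "generate G {s, y} = U"
proof -
  obtain f where f: "f \<in> iso (G\<lparr>carrier := U\<rparr>) (dihedral_group 3)" using iso by (auto simp: is_iso_def)
  note F = iso_subgroup_facts[OF U f group_dihedral[of 3, simplified]]
  note UC = subgroup.m_closed[OF U]
  obtain i b where ib: "f y = (i, b)" "0 \<le> i" "i < 3"
    using imageI[OF y(1), of f] unfolding F(4) by (cases "f y") (simp add: carrier_dihedral)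
  have b: "\<not> b"
  proof
    assume "b"
    then have "f (y \<otimes> (y \<otimes> y)) = (i, True)" using F(1) y(1) UC ib by (simp add: mult_dihedral)
    then show False using y(2) F(2) by (simp add: one_dihedral)
  qed
  have "(0, True) \<in> f ` U" unfolding F(4) by (simp add: carrier_dihedral)
  then obtain s where s: "s \<in> U" "f s = (0, True)" by (metis imageE)
  have "s \<otimes> s = \<one>"
    by (rule inj_onD[OF F(3)]) (use s UC subgroup.one_closed[OF U] F in \<open>simp_all add: mult_dihedral one_dihedral\<close>)
  moreover have "s \<otimes> y = y \<otimes> (y \<otimes> s)"
    by (rule inj_onD[OF F(3)]) (use s y UC F(1) ib b in \<open>simp_all add: mult_dihedral, presburger\<close>)
  moreover have "s \<noteq> \<one>" using s F(2) by (auto simp: one_dihedral)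
  ultimately show thesis
    using that[OF s(1)] generate_involution_order_3[OF fin U _ s(1) _ _ y] card_dihedral_subgroup[OF U f] by simp
qed

lemma D2_involution:
  assumes fin: "finite (carrier G)" and V: "subgroup V G" and iso: "G\<lparr>carrier := V\<rparr> \<cong> dihedral_group 2"
    and a: "a \<in> V" "a \<noteq> \<one>"
  obtains c where "c \<in> V" "c \<otimes> c = \<one>" "a \<otimes> c = c \<otimes> a" "V = {\<one>, a, c, a \<otimes> c}"
proof -
  obtain f where f: "f \<in> iso (G\<lparr>carrier := V\<rparr>) (dihedral_group 2)" using iso by (auto simp: is_iso_def)
  note F = iso_subgroup_facts[OF V f group_dihedral[of 2, simplified]]
  note VC = subgroup.m_closed[OF V] and VG = subgroup.mem_carrier[OF V]
  have sq: "u \<otimes> u = \<one>" if u: "u \<in> V" for u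
  proof -
    have "f u \<otimes>\<^bsub>dihedral_group 2\<^esub> f u = \<one>\<^bsub>dihedral_group 2\<^esub>"
      by (cases "f u") (auto simp: mult_dihedral one_dihedral)
    then have "f (u \<otimes> u) = f \<one>" using F(1,2) u by simp
    then show ?thesis using inj_onD[OF F(3)] VC[OF u u] subgroup.one_closed[OF V] by blast
  qed
  have V4: "card V = 4" using card_dihedral_subgroup[OF V f] by simp
  have "card {\<one>, a} = 2" using a by auto
  then have "V \<noteq> {\<one>, a}" using V4 by auto
  then obtain c where c: "c \<in> V" "c \<noteq> \<one>" "c \<noteq> a" using a subgroup.one_closed[OF V] by blast
  have inv: "inv u = u" if "u \<in> V" for u using sq[OF that] VG[OF that] by (intro inv_equality) auto
  have "inv (a \<otimes> c) = inv c \<otimes> inv a" using a c VG by (simp add: inv_mult_group)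
  then have ac: "a \<otimes> c = c \<otimes> a" using inv a c VC by simp
  have "a \<otimes> c \<noteq> \<one>"
  proof
    assume "a \<otimes> c = \<one>"
    then have "a = inv c" using VG a c by (simp add: inv_equality)
    then show False using inv c by simp
  qed
  moreover have "a \<otimes> c \<noteq> a" "a \<otimes> c \<noteq> c" using a c VG by auto
  ultimately have "card {\<one>, a, c, a \<otimes> c} = 4" using a c by auto
  moreover have "{\<one>, a, c, a \<otimes> c} \<subseteq> V" using a c VC subgroup.one_closed[OF V] by blast
  ultimately have "V = {\<one>, a, c, a \<otimes> c}" using V4 finite_subgroup[OF fin V] card_subset_eq by metis
  then show thesis using that c(1) sq[OF c(1)] ac by blast
qed

end

text \<open>The image of 1 and the involution property leave the identity, six transpositions and
  three double transpositions; parity removes the transpositions.\<close>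

lemma even_involution_4:
  assumes g: "g permutes {1..4::nat}" "evenperm g" "g \<circ> g = id"
  shows "g \<in> {id, tau 1 2 \<circ> tau 3 4, tau 1 3 \<circ> tau 2 4, tau 1 4 \<circ> tau 2 3}"
proof -
  have gg: "g (g z) = z" for z using fun_cong[OF g(3), of z] by simp
  have out: "g z = z" if "z \<noteq> 1" "z \<noteq> 2" "z \<noteq> 3" "z \<noteq> 4" for z
    using permutes_not_in[OF g(1), of z] that by auto
  have r: "g z = 1 \<or> g z = 2 \<or> g z = 3 \<or> g z = 4" if "z \<in> {1..4}" for z
    using permutes_in_image[OF g(1), of z] that by auto
  have odd: "g \<noteq> tau i j" if "i \<noteq> j" for i j using that g(2) evenperm_swap by metis
  have eq: "g = h" if "g 1 = h 1" "g 2 = h 2" "g 3 = h 3" "g 4 = h 4"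
    "\<And>z. z \<noteq> 1 \<Longrightarrow> z \<noteq> 2 \<Longrightarrow> z \<noteq> 3 \<Longrightarrow> z \<noteq> 4 \<Longrightarrow> h z = z" for h
    by (rule fun_eq_4) (use that out in auto)
  consider "g 1 = 1" | "g 1 = 2" | "g 1 = 3" | "g 1 = 4" using r[of 1] by auto
  then show ?thesis
  proof cases
    case 1
    consider "g 2 = 2" | "g 2 = 3" | "g 2 = 4" using r[of 2] gg[of 2] 1 by auto
    then show ?thesis
    proof cases
      case 1
      consider "g 3 = 3" "g 4 = 4" | "g 3 = 4" "g 4 = 3"
        using r[of 3] r[of 4] gg[of 3] gg[of 4] gg[of 2] 1 \<open>g 1 = 1\<close> by auto
      then show ?thesis
      proof cases
        case a: 1
        have "g = id" by (rule eq) (use 1 a \<open>g 1 = 1\<close> in simp_all)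
        then show ?thesis by simp
      next
        case a: 2
        have "g = tau 3 4" by (rule eq) (use 1 a \<open>g 1 = 1\<close> in \<open>simp_all add: transpose_def\<close>)
        then show ?thesis using odd[of 3 4] by simp
      qed
    next
      case 2
      then have "g 3 = 2" "g 4 = 4" using gg[of 2] r[of 4] gg[of 4] \<open>g 1 = 1\<close> by auto
      then have "g = tau 2 3" by (intro eq) (use 2 \<open>g 1 = 1\<close> in \<open>simp_all add: transpose_def\<close>)
      then show ?thesis using odd[of 2 3] by simp
    next
      case 3
      then have "g 4 = 2" "g 3 = 3" using gg[of 2] r[of 3] gg[of 3] \<open>g 1 = 1\<close> by auto
      then have "g = tau 2 4" by (intro eq) (use 3 \<open>g 1 = 1\<close> in \<open>simp_all add: transpose_def\<close>)
      then show ?thesis using odd[of 2 4] by simp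
    qed
  next
    case 2
    then have g2: "g 2 = 1" using gg[of 1] by simp
    consider "g 3 = 3" "g 4 = 4" | "g 3 = 4" "g 4 = 3"
      using r[of 3] r[of 4] gg[of 3] gg[of 4] 2 g2 by auto
    then show ?thesis
    proof cases
      case a: 1
      have "g = tau 1 2" by (rule eq) (use 2 g2 a in \<open>simp_all add: transpose_def\<close>)
      then show ?thesis using odd[of 1 2] by simp
    next
      case a: 2
      have "g = tau 1 2 \<circ> tau 3 4" by (rule eq) (use 2 g2 a in \<open>simp_all add: transpose_def\<close>)
      then show ?thesis by blast
    qed
  next
    case 3
    then have g2: "g 3 = 1" using gg[of 1] by simp
    consider "g 2 = 2" "g 4 = 4" | "g 2 = 4" "g 4 = 2"
      using r[of 2] r[of 4] gg[of 2] gg[of 4] 3 g2 by auto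
    then show ?thesis
    proof cases
      case a: 1
      have "g = tau 1 3" by (rule eq) (use 3 g2 a in \<open>simp_all add: transpose_def\<close>)
      then show ?thesis using odd[of 1 3] by simp
    next
      case a: 2
      have "g = tau 1 3 \<circ> tau 2 4" by (rule eq) (use 3 g2 a in \<open>simp_all add: transpose_def\<close>)
      then show ?thesis by blast
    qed
  next
    case 4
    then have g2: "g 4 = 1" using gg[of 1] by simp
    consider "g 2 = 2" "g 3 = 3" | "g 2 = 3" "g 3 = 2"
      using r[of 2] r[of 3] gg[of 2] gg[of 3] 4 g2 by auto
    then show ?thesis
    proof cases
      case a: 1
      have "g = tau 1 4" by (rule eq) (use 4 g2 a in \<open>simp_all add: transpose_def\<close>)
      then show ?thesis using odd[of 1 4] by simp
    next
      case a: 2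
      have "g = tau 1 4 \<circ> tau 2 3" by (rule eq) (use 4 g2 a in \<open>simp_all add: transpose_def\<close>)
      then show ?thesis by blast
    qed
  qed
qed

text \<open>The centralizer of (1 2)(3 4) in the symmetric group of degree 4 has order 8, prime to
  3. Concretely, commutation determines \<open>q\<close> at 2 and 4 from its values at 1 and 3, and
  the finitely many choices are checked.\<close>

lemma order_3_not_commuting:
  assumes q: "q permutes {1..4::nat}" "q \<circ> (q \<circ> q) = id" and c: "q \<circ> (tau 1 2 \<circ> tau 3 4) = (tau 1 2 \<circ> tau 3 4) \<circ> q"
  shows "q = id"
proof -
  have qqq: "q (q (q z)) = z" for z using fun_cong[OF q(2), of z] by simp
  have r: "q z = 1 \<or> q z = 2 \<or> q z = 3 \<or> q z = 4" if "z \<in> {1..4}" for z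
    using permutes_in_image[OF q(1), of z] that by auto
  have "q 2 = tau 1 2 (tau 3 4 (q 1))" "q 4 = tau 1 2 (tau 3 4 (q 3))"
    using fun_cong[OF c, of 1] fun_cong[OF c, of 3] by (simp_all add: transpose_def)
  then have v: "q 1 = 1 \<and> q 2 = 2 \<and> q 3 = 3 \<and> q 4 = 4"
    using r[of 1] r[of 3] qqq[of 1] qqq[of 3] by (auto simp: transpose_def)
  show ?thesis
  proof (rule fun_eq_4)
    show "q z = id z" if "z \<noteq> 1" "z \<noteq> 2" "z \<noteq> 3" "z \<noteq> 4" for z
      using permutes_not_in[OF q(1), of z] that by auto
  qed (use v in simp_all)
qed

context group
begin

text \<open>The preimage of (1 2)(3 4) is taken as \<open>v\<close>. Since \<open>y\<close> has
  order 3 and does not commute with it, conjugation by \<open>y\<close> cycles the three involutions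
  of \<open>V\<close>. Which of the two cyclic orders occurs is immaterial, because the product of
  any two of them is the third.\<close>

lemma A4_klein:
  assumes V: "subgroup V G" and iso: "G\<lparr>carrier := V\<rparr> \<cong> alt_group 4"
    and y: "y \<in> V" "y \<otimes> (y \<otimes> y) = \<one>" "y \<noteq> \<one>"
  obtains v where "v \<in> V" "v \<noteq> \<one>"
    "v \<otimes> (y \<otimes> v \<otimes> inv y) = y \<otimes> (y \<otimes> v \<otimes> inv y) \<otimes> inv y"
    "\<And>g. g \<in> V \<Longrightarrow> g \<otimes> g = \<one> \<longleftrightarrow>
      g \<in> {\<one>, v, y \<otimes> v \<otimes> inv y, y \<otimes> (y \<otimes> v \<otimes> inv y) \<otimes> inv y}"
proof -
  obtain f where f: "f \<in> iso (G\<lparr>carrier := V\<rparr>) (alt_group 4)" using iso by (auto simp: is_iso_def)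
  note F = iso_subgroup_facts[OF V f alt_group_is_group, unfolded alt_group_mult alt_group_one]
  note VC = subgroup.m_closed[OF V] and VI = subgroup.m_inv_closed[OF V]
    and VG = subgroup.mem_carrier[OF V] and V1 = subgroup.one_closed[OF V]
  have pre: "\<exists>u. u \<in> V \<and> f u = tau i j \<circ> tau k l"
    if "i \<noteq> j" "k \<noteq> l" "{i, j, k, l} \<subseteq> {1..4}" for i j k l
  proof -
    have "tau i j \<circ> tau k l \<in> carrier (alt_group 4)"
      using that unfolding alt_group_carrier
      by (auto intro!: permutes_compose permutes_swap_id
          simp: evenperm_comp permutation_swap_id evenperm_swap)
    then show ?thesis using F(4) by (metis imageE)
  qed
  obtain t where t: "t \<in> V" "f t = tau 1 2 \<circ> tau 3 4" using pre[of 1 2 3 4] by auto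
  obtain t' where t': "t' \<in> V" "f t' = tau 1 3 \<circ> tau 2 4" using pre[of 1 3 2 4] by auto
  obtain t'' where t'': "t'' \<in> V" "f t'' = tau 1 4 \<circ> tau 2 3" using pre[of 1 4 2 3] by auto
  have eqI: "u = w" if "u \<in> V" "w \<in> V" "f u = f w" for u w using inj_onD[OF F(3)] that by blast
  have sq: "t \<otimes> t = \<one>" "t' \<otimes> t' = \<one>" "t'' \<otimes> t'' = \<one>"
    by (rule eqI; use VC V1 F(1,2) t t' t'' in \<open>simp\<close>; rule fun_eq_4; simp add: transpose_def)+
  have prd: "t \<otimes> t' = t''" "t \<otimes> t'' = t'"
    by (rule eqI; use VC V1 F(1,2) t t' t'' in \<open>simp\<close>; rule fun_eq_4; simp add: transpose_def)+
  have t1: "t \<noteq> \<one>"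
  proof
    assume "t = \<one>"
    then have "tau 1 2 \<circ> tau 3 4 = id" using t F(2) by simp
    from fun_cong[OF this, of 1] show False by (simp add: transpose_def)
  qed
  have inv: "g \<otimes> g = \<one> \<longleftrightarrow> g \<in> {\<one>, t, t', t''}" if g: "g \<in> V" for g
  proof
    assume gg: "g \<otimes> g = \<one>"
    have "f g \<in> carrier (alt_group 4)" using F(4) g by blast
    moreover have "f g \<circ> f g = id" using F(1)[OF g g] gg F(2) by simp
    ultimately have "f g \<in> {id, tau 1 2 \<circ> tau 3 4, tau 1 3 \<circ> tau 2 4, tau 1 4 \<circ> tau 2 3}"
      using even_involution_4 unfolding alt_group_carrier by blast
    then have "f g = f \<one> \<or> f g = f t \<or> f g = f t' \<or> f g = f t''" using F(2) t t' t'' by auto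
    then show "g \<in> {\<one>, t, t', t''}" using eqI g V1 t t' t'' by blast
  qed (use sq in auto)
  have yG: "y \<in> carrier G" and tG: "t \<in> carrier G" using y t VG by auto
  have nc: "y \<otimes> t \<noteq> t \<otimes> y"
  proof
    assume "y \<otimes> t = t \<otimes> y"
    then have "f y \<circ> f t = f t \<circ> f y" using F(1) y t by metis
    then have e: "f y \<circ> (tau 1 2 \<circ> tau 3 4) = (tau 1 2 \<circ> tau 3 4) \<circ> f y" using t by simp
    have "f (y \<otimes> (y \<otimes> y)) = f y \<circ> (f y \<circ> f y)" using F(1) y(1) VC by simp
    then have "f y \<circ> (f y \<circ> f y) = id" using y(2) F(2) by simp
    moreover have "f y permutes {1..4}" using F(4) y(1) alt_group_carrier by blast
    ultimately have "f y = id" using order_3_not_commuting e by blast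
    then have "f y = f \<one>" using F(2) by simp
    then show False using eqI y V1 by blast
  qed
  define v\<^sub>1 where "v\<^sub>1 = y \<otimes> t \<otimes> inv y"
  define v\<^sub>2 where "v\<^sub>2 = y \<otimes> v\<^sub>1 \<otimes> inv y"
  have v1V: "v\<^sub>1 \<in> V" unfolding v\<^sub>1_def using VC VI y t by blast
  have v2V: "v\<^sub>2 \<in> V" unfolding v\<^sub>2_def using VC VI y v1V by blast
  have v1G: "v\<^sub>1 \<in> carrier G" using v1V VG by blast
  have cinj: "u = w" if "u \<in> carrier G" "w \<in> carrier G" "y \<otimes> u \<otimes> inv y = y \<otimes> w \<otimes> inv y" for u w
    using that yG by simp
  have csq: "(y \<otimes> u \<otimes> inv y) \<otimes> (y \<otimes> u \<otimes> inv y) = \<one>" if "u \<in> carrier G" "u \<otimes> u = \<one>" for u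
  proof -
    have "(y \<otimes> u \<otimes> inv y) \<otimes> (y \<otimes> u \<otimes> inv y) = y \<otimes> (u \<otimes> u) \<otimes> inv y"
      using that(1) yG by (simp add: m_assoc inv_cancel_left)
    then show ?thesis using that(2) yG by simp
  qed
  have v1t: "v\<^sub>1 \<noteq> t"
  proof
    assume "v\<^sub>1 = t"
    then have "y \<otimes> t \<otimes> inv y \<otimes> y = t \<otimes> y" unfolding v\<^sub>1_def by simp
    then show False using nc yG tG by (simp add: m_assoc)
  qed
  have v10: "v\<^sub>1 \<noteq> \<one>" using cinj[of t \<one>] t1 yG tG unfolding v\<^sub>1_def by auto
  have v20: "v\<^sub>2 \<noteq> \<one>" using cinj[of v\<^sub>1 \<one>] v10 yG v1G unfolding v\<^sub>2_def by auto
  have v21: "v\<^sub>2 \<noteq> v\<^sub>1"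
    using cinj[of v\<^sub>1 t] v1t v1G tG unfolding v\<^sub>2_def by (auto simp: v\<^sub>1_def)
  \<comment> \<open>If the second conjugate returned to \<open>t\<close>, one more conjugation would
    give \<open>v\<^sub>1\<close>, but three conjugations by \<open>y\<close> act trivially, so
    \<open>v\<^sub>1\<close> would be \<open>t\<close>.\<close>
  have v2t: "v\<^sub>2 \<noteq> t"
  proof
    assume "v\<^sub>2 = t"
    then have "v\<^sub>1 = y \<otimes> v\<^sub>2 \<otimes> inv y" unfolding v\<^sub>1_def by simp
    also have "\<dots> = (y \<otimes> (y \<otimes> y)) \<otimes> t \<otimes> inv (y \<otimes> (y \<otimes> y))"
      unfolding v\<^sub>2_def v\<^sub>1_def using yG tG by (simp add: m_assoc inv_mult_group)
    also have "\<dots> = t" unfolding y(2) using tG by simp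
    finally show False using v1t by simp
  qed
  have sq1: "v\<^sub>1 \<otimes> v\<^sub>1 = \<one>" unfolding v\<^sub>1_def by (rule csq[OF tG sq(1)])
  have sq2: "v\<^sub>2 \<otimes> v\<^sub>2 = \<one>" unfolding v\<^sub>2_def by (rule csq[OF v1G sq1])
  have "v\<^sub>1 \<in> {t', t''}" "v\<^sub>2 \<in> {t', t''}"
    using inv[OF v1V] inv[OF v2V] sq1 sq2 v10 v20 v1t v2t by auto
  then have d: "v\<^sub>1 = t' \<and> v\<^sub>2 = t'' \<or> v\<^sub>1 = t'' \<and> v\<^sub>2 = t'" using v21 by auto
  then have "t \<otimes> v\<^sub>1 = v\<^sub>2" using prd by auto
  moreover have "g \<otimes> g = \<one> \<longleftrightarrow> g \<in> {\<one>, t, v\<^sub>1, v\<^sub>2}" if "g \<in> V" for g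
    using inv[OF that] d by auto
  ultimately show thesis using that[OF t(1) t1] unfolding v\<^sub>2_def v\<^sub>1_def by blast
qed

text \<open>The nontrivial element of the intersection serves as the common \<open>a\<close>;
  \<open>x\<close> and \<open>c\<close> are then chosen relative to it in \<open>U\<close> and in
  \<open>V\<close> separately, so the two isomorphisms need not be compatible.\<close>

lemma cond_a_amalgam:
  assumes fin: "finite (carrier G)" and U: "subgroup U G" and V: "subgroup V G"
    and gen: "generate G (U \<union> V) = carrier G" and a: "cond_a G U V"
  obtains a x c where "D3_D2_amalgam G a x c"
proof -
  have s: "subgroup (U \<inter> V) G" by (rule subgroups_Inter_pair[OF U V])
  have "card (U \<inter> V) = 2"
    using iso_same_card[of "G\<lparr>carrier := U \<inter> V\<rparr>" "integer_mod_group 2"] a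
    by (simp add: cond_a_def carrier_integer_mod_group)
  then have "U \<inter> V \<noteq> {\<one>}" by auto
  then obtain a where a1: "a \<in> U" "a \<in> V" "a \<noteq> \<one>" using subgroup.one_closed[OF s] by blast
  have aG: "a \<in> carrier G" using a1 subgroup.mem_carrier[OF U] by blast
  have aa: "a \<otimes> a = \<one>"
    using pow_card_subgroup[OF fin s, of a] a1 aG \<open>card (U \<inter> V) = 2\<close> by (simp add: numeral_2_eq_2)
  obtain x where x: "x \<in> U" "x \<otimes> (x \<otimes> x) = \<one>" "a \<otimes> x = x \<otimes> (x \<otimes> a)" "generate G {a, x} = U"
    using D3_involution[OF fin U _ a1(1) aa a1(3)] a cond_a_def by metis
  obtain c where c: "c \<in> V" "c \<otimes> c = \<one>" "a \<otimes> c = c \<otimes> a" "V = {\<one>, a, c, a \<otimes> c}"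
    using D2_involution[OF fin V _ a1(2,3)] a cond_a_def by metis
  have xc: "x \<in> carrier G" "c \<in> carrier G"
    using x(1) c(1) subgroup.mem_carrier[OF U] subgroup.mem_carrier[OF V] by auto
  have sub: "{a, x, c} \<subseteq> carrier G" using aG xc by simp
  have gs: "subgroup (generate G {a, x, c}) G" by (rule generate_is_subgroup[OF sub])
  have m: "a \<in> generate G {a, x, c}" "c \<in> generate G {a, x, c}" by (auto intro: generate.incl)
  have "U \<subseteq> generate G {a, x, c}" unfolding x(4)[symmetric] by (rule mono_generate) blast
  moreover have "V \<subseteq> generate G {a, x, c}"
    unfolding c(4) using m subgroup.one_closed[OF gs] subgroup.m_closed[OF gs] by blast
  ultimately have "carrier G \<subseteq> generate G {a, x, c}"
    using generate_subgroup_incl[OF _ gs, of "U \<union> V"] gen by simp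
  then have "generate G {a, x, c} = carrier G" using generate_incl[OF sub] by blast
  then have "D3_D2_amalgam G a x c"
    by unfold_locales (simp_all add: fin aG xc aa c(2,3) x(2,3))
  then show thesis by (rule that)
qed

lemma cond_b_amalgam:
  assumes fin: "finite (carrier G)" and U: "subgroup U G" and V: "subgroup V G"
    and gen: "generate G (U \<union> V) = carrier G" and b: "cond_b G U V"
  obtains v y s where "D3_A4_amalgam G V v y s"
proof -
  have s: "subgroup (U \<inter> V) G" by (rule subgroups_Inter_pair[OF U V])
  have c3: "card (U \<inter> V) = 3"
    using iso_same_card[of "G\<lparr>carrier := U \<inter> V\<rparr>" "integer_mod_group 3"] b
    by (simp add: cond_b_def carrier_integer_mod_group)
  then have "U \<inter> V \<noteq> {\<one>}" by auto
  then obtain y where y: "y \<in> U" "y \<in> V" "y \<noteq> \<one>" using subgroup.one_closed[OF s] by blast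
  have yG: "y \<in> carrier G" using y subgroup.mem_carrier[OF U] by blast
  have y3: "y \<otimes> (y \<otimes> y) = \<one>"
    using pow_card_subgroup[OF fin s, of y] y yG c3 by (simp add: numeral_3_eq_3 m_assoc)
  obtain s where s: "s \<in> U" "s \<otimes> s = \<one>" "s \<otimes> y = y \<otimes> (y \<otimes> s)" "generate G {s, y} = U"
    using D3_rotation[OF fin U _ y(1) y3 y(3)] b cond_b_def by metis
  obtain v where v: "v \<in> V" "v \<noteq> \<one>"
    "v \<otimes> (y \<otimes> v \<otimes> inv y) = y \<otimes> (y \<otimes> v \<otimes> inv y) \<otimes> inv y"
    "\<And>g. g \<in> V \<Longrightarrow> g \<otimes> g = \<one> \<longleftrightarrow>
      g \<in> {\<one>, v, y \<otimes> v \<otimes> inv y, y \<otimes> (y \<otimes> v \<otimes> inv y) \<otimes> inv y}"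
    by (rule A4_klein[OF V _ y(2) y3 y(3)]) (use b cond_b_def in blast)+
  have sG: "s \<in> carrier G" using s(1) subgroup.mem_carrier[OF U] by blast
  have sub: "insert s V \<subseteq> carrier G" using sG subgroup.subset[OF V] by simp
  have gs: "subgroup (generate G (insert s V)) G" by (rule generate_is_subgroup[OF sub])
  have "U \<subseteq> generate G (insert s V)"
    unfolding s(4)[symmetric] by (rule mono_generate) (use y in blast)
  moreover have "V \<subseteq> generate G (insert s V)" by (auto intro: generate.incl)
  ultimately have "carrier G \<subseteq> generate G (insert s V)"
    using generate_subgroup_incl[OF _ gs, of "U \<union> V"] gen by simp
  then have g: "generate G (insert s V) = carrier G" using generate_incl[OF sub] by blast
  have V12: "card V = 12"
  proof -
    have "card V = card (carrier (alt_group 4))"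
      using iso_same_card[of "G\<lparr>carrier := V\<rparr>" "alt_group 4"] b by (simp add: cond_b_def)
    then show ?thesis using alt_group_card_carrier[of 4] by (simp add: fact_numeral)
  qed
  have "D3_A4_amalgam G V v y s"
    by (intro D3_A4_amalgam.intro D3_A4_amalgam_axioms.intro) (fact is_group fin V V12 v y s y3 sG g)+
  then show thesis by (rule that)
qed

end

theorem theoremA1:
  fixes G :: "('a, 'b) monoid_scheme" and U V :: "'a set"
  assumes "group G" and "finite (carrier G)"
    and "subgroup U G" and "subgroup V G"
    and "generate G (U \<union> V) = carrier G"
  shows "(card (carrier G) = 48 \<and> cond_a G U V \<longrightarrow> G \<cong> sym_group 4 \<times>\<times> integer_mod_group 2)
    \<and> (card (carrier G) = 48 \<longrightarrow> \<not> cond_b G U V)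
    \<and> (card (carrier G) = 72 \<longrightarrow> \<not> cond_a G U V \<and> \<not> cond_b G U V)"
proof -
  interpret group G by fact
  have a: "(card (carrier G) = 48 \<longrightarrow> G \<cong> sym_group 4 \<times>\<times> integer_mod_group 2) \<and> card (carrier G) \<noteq> 72"
    if ca: "cond_a G U V"
  proof -
    obtain a x c where "D3_D2_amalgam G a x c"
      using cond_a_amalgam[OF assms(2-5) ca] .
    then interpret D3_D2_amalgam G a x c .
    show ?thesis using iso_S4_Z2 card_ne_72 by blast
  qed
  have b: "card (carrier G) \<noteq> 48 \<and> card (carrier G) \<noteq> 72" if cb: "cond_b G U V"
  proof -
    obtain v y s where "D3_A4_amalgam G V v y s"
      using cond_b_amalgam[OF assms(2-5) cb] .
    then interpret D3_A4_amalgam G V v y s .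
    show ?thesis using card_ne_48 card_ne_72 by blast
  qed
  show ?thesis using a b by blast
qed

end
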